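(* Let $\gamma\in(0,1/3)$, $C>0$, and let $(K_x)_{x\in\mathbb{Z}}$ be i.i.d. $[0,\infty)$-valued random variables on a probability space $(\Omega,\mathcal{G},\mathbf{P})$ such that $\mathbf{P}(K_0>t)\ge C t^{-\gamma}$ for all $t\ge 1$. Then for $\mathbf{P}$-almost every $\omega\in\Omega$, the graph $\mathrm{Comb}(\mathbb{Z},K^\omega)$ has the finite collision property.
   Context: For a profile $K=(K_x)_{x\in\mathbb{Z}}\in[0,\infty)^{\mathbb{Z}}$, the comb graph $\mathrm{Comb}(\mathbb{Z},K)$ has vertex set $V=\{(x,\ell)\in\mathbb{Z}\times\mathbb{N}_0: 0\le \ell\le K_x\}$; its edges are $\{(x,0),(y,0)\}$ for $|x-y|=1$, and $\{(x,\ell),(x,k)\}$ for $x\in\mathbb{Z}$, $|\ell-k|=1$ (both endpoints in $V$). $K^\omega=(K_x(\omega))_{x\in\mathbb{Z}}$. A connected, locally finite graph $G=(V,E)$ has the finite collision property if, for some $x\in V$, two independent discrete-time simple random walks $(X^1_n)_{n\ge 0},(X^2_n)_{n\ge0}$ on $G$, both started at $x$, satisfy that the set $\{n: X^1_n=X^2_n\}$ is almost surely finite. *)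

theory Defs
  imports "HOL-Probability.Probability"
begin

section \<open>Graphs\<close>

record 'v graph =
  verts :: "'v set"
  edges :: "'v set set"

definition neighbours :: "'v graph \<Rightarrow> 'v \<Rightarrow> 'v set" where
  "neighbours G v = {w \<in> verts G. {v, w} \<in> edges G}"

locale connected_locally_finite_graph =
  fixes G :: "'v graph"
  assumes nonempty: "verts G \<noteq> {}"
    and edges_pairs: "e \<in> edges G \<Longrightarrow> e \<subseteq> verts G \<and> card e = 2"
    and graph_connected: "u \<in> verts G \<Longrightarrow> v \<in> verts G \<Longrightarrow> (u, v) \<in> {(a, b). {a, b} \<in> edges G}\<^sup>*"
    and locally_finite: "v \<in> verts G \<Longrightarrow> finite (neighbours G v)"

section \<open>Simple random walk\<close>

text \<open>
  The one-step distribution is meaningful only when \<^term>\<open>v\<close> has at least one and at most finitely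
  many neighbours; this holds for every vertex of a connected, locally finite graph with at least
  two vertices.
\<close>

definition srw_step :: "'v graph \<Rightarrow> 'v \<Rightarrow> 'v pmf" where
  "srw_step G v = pmf_of_set (neighbours G v)"

text \<open>
  A process on an arbitrary probability space is a simple random walk started at \<^term>\<open>x\<close> iff its
  finite-dimensional distributions are the Markovian ones.
\<close>

definition simple_random_walk ::
  "'v graph \<Rightarrow> 'v \<Rightarrow> 'w measure \<Rightarrow> (nat \<Rightarrow> 'w \<Rightarrow> 'v) \<Rightarrow> bool" where
  "simple_random_walk G x M X \<longleftrightarrow>
     prob_space M \<and> (\<forall>n. X n \<in> measurable M (count_space UNIV)) \<and>
     (\<forall>n p. measure M {\<omega> \<in> space M. \<forall>i\<le>n. X i \<omega> = p i} =
        (if p 0 = x then \<Prod>i<n. pmf (srw_step G (p i)) (p (Suc i)) else 0))"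

abbreviation trajectories :: "(nat \<Rightarrow> 'v) measure" where
  "trajectories \<equiv> PiM UNIV (\<lambda>_. count_space UNIV)"

text \<open>
  The law of the simple random walk on the space of trajectories. It is realised by drawing
  independently, for every time \<^term>\<open>n\<close> and every vertex \<^term>\<open>v\<close>, the vertex
  \<open>\<xi> (n, v)\<close> to which the walk moves if it is at \<^term>\<open>v\<close> at time \<^term>\<open>n\<close>.
  That this is the law of every simple random walk is shown by \<open>simple_random_walk_srw_law\<close>
  and \<open>distr_simple_random_walk\<close> below.
\<close>

primrec trajectory :: "'v \<Rightarrow> (nat \<times> 'v \<Rightarrow> 'v) \<Rightarrow> nat \<Rightarrow> 'v" where
  "trajectory x \<xi> 0 = x"
| "trajectory x \<xi> (Suc n) = \<xi> (n, trajectory x \<xi> n)"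

definition srw_law :: "'v graph \<Rightarrow> 'v \<Rightarrow> (nat \<Rightarrow> 'v) measure" where
  "srw_law G x =
     distr (PiM UNIV (\<lambda>(n, v). measure_pmf (srw_step G v))) trajectories (trajectory x)"

text \<open>
  Two independent walks started at \<^term>\<open>x\<close> have the product law; see
  \<open>AE_finite_collisions_iff\<close> for arbitrary pairs of independent walks.
  The property is only of interest for connected, locally finite graphs; comb graphs over a
  nonnegative profile are such graphs by \<open>connected_locally_finite_graph_comb\<close>.
\<close>

definition finite_collision_property :: "'v::countable graph \<Rightarrow> bool" where
  "finite_collision_property G \<longleftrightarrow>
     (\<exists>x\<in>verts G. AE (X1, X2) in srw_law G x \<Otimes>\<^sub>M srw_law G x. finite {n. X1 n = X2 n})"

section \<open>Comb graphs over the integers\<close>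

definition comb :: "(int \<Rightarrow> real) \<Rightarrow> (int \<times> nat) graph" where
  "comb K =
    (let V = {(x, l). real l \<le> K x} in
     \<lparr> verts = V,
       edges = {{(x, 0), (y, 0)} | x y. \<bar>x - y\<bar> = 1 \<and> (x, 0) \<in> V \<and> (y, 0) \<in> V} \<union>
               {{(x, l), (x, k)} | x l k. \<bar>int l - int k\<bar> = 1 \<and> (x, l) \<in> V \<and> (x, k) \<in> V} \<rparr>)"

section \<open>Consistency of the definitions\<close>

lemma verts_comb: "(x, l) \<in> verts (comb K) \<longleftrightarrow> real l \<le> K x"
  by (simp add: comb_def)

lemma edges_comb:
  "{(x, l), (y, k)} \<in> edges (comb K) \<longleftrightarrow>
     real l \<le> K x \<and> real k \<le> K y \<and>
     (l = 0 \<and> k = 0 \<and> \<bar>x - y\<bar> = 1 \<or> x = y \<and> \<bar>int l - int k\<bar> = 1)"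
  (is "?L \<longleftrightarrow> ?R")
proof
  assume ?L
  then consider x' y' where "{(x, l), (y, k)} = {(x', 0), (y', 0)}" "\<bar>x' - y'\<bar> = 1"
      "0 \<le> K x'" "0 \<le> K y'"
    | x' l' k' where "{(x, l), (y, k)} = {(x', l'), (x', k')}" "\<bar>int l' - int k'\<bar> = 1"
      "real l' \<le> K x'" "real k' \<le> K x'"
    by (auto simp: comb_def Let_def)
  then show ?R
    by cases (auto simp: doubleton_eq_iff abs_minus_commute)
next
  assume ?R
  then show ?L
    by (auto simp: comb_def Let_def)
qed

lemma connected_locally_finite_graph_comb:
  assumes K: "\<And>x. K x \<ge> 0"
  shows "connected_locally_finite_graph (comb K)"
proof
  let ?E = "{(a, b). {a, b} \<in> edges (comb K)}"
  show "verts (comb K) \<noteq> {}"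
    using K[of 0] verts_comb[of 0 0 K] by auto
  show "e \<subseteq> verts (comb K) \<and> card e = 2" if "e \<in> edges (comb K)" for e
    using that by (auto simp: comb_def card_insert_if)
  have sym: "sym (?E\<^sup>*)"
    by (rule sym_rtrancl, rule symI) (simp add: insert_commute)
  have down: "((x, l), (x, 0)) \<in> ?E\<^sup>*" if "real l \<le> K x" for x l
    using that
  proof (induction l)
    case (Suc l)
    then have "((x, Suc l), (x, l)) \<in> ?E"
      by (simp add: edges_comb)
    moreover have "((x, l), (x, 0)) \<in> ?E\<^sup>*"
      using Suc by simp
    ultimately show ?case
      by (rule converse_rtrancl_into_rtrancl)
  qed simp
  have base: "((x, 0), (x + int n, 0)) \<in> ?E\<^sup>*" for x n
  proof (induction n)
    case (Suc n)
    have "((x + int n, 0), (x + int (Suc n), 0)) \<in> ?E"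
      using K by (simp add: edges_comb)
    with Suc show ?case
      by (rule rtrancl_into_rtrancl)
  qed simp
  have base': "((x, 0), (y, 0)) \<in> ?E\<^sup>*" for x y
  proof (cases "x \<le> y")
    case True
    then show ?thesis using base[of x "nat (y - x)"] by simp
  next
    case False
    then show ?thesis using symD[OF sym base[of y "nat (x - y)"]] by simp
  qed
  show "(u, v) \<in> ?E\<^sup>*" if "u \<in> verts (comb K)" "v \<in> verts (comb K)" for u v
  proof -
    obtain x l y k where [simp]: "u = (x, l)" "v = (y, k)"
      by (cases u, cases v)
    have "((x, l), (x, 0)) \<in> ?E\<^sup>*"
      using that down[of l x] by (simp add: verts_comb)
    also have "((x, 0), (y, 0)) \<in> ?E\<^sup>*"
      by (rule base')
    also have "((y, 0), (y, k)) \<in> ?E\<^sup>*"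
      using that symD[OF sym down[of k y]] by (simp add: verts_comb)
    finally show ?thesis by simp
  qed
  show "finite (neighbours (comb K) v)" for v
  proof -
    obtain x l where [simp]: "v = (x, l)" by (cases v)
    have "neighbours (comb K) v \<subseteq> {x - 1..x + 1} \<times> {..Suc l}"
      by (auto simp: neighbours_def edges_comb)
    then show ?thesis
      by (rule finite_subset) auto
  qed
qed

lemma neighbours_comb_nonempty:
  assumes "\<And>x. K x \<ge> 0" and "v \<in> verts (comb K)"
  shows "neighbours (comb K) v \<noteq> {}"
proof -
  obtain x l where v: "v = (x, l)" by (cases v)
  show ?thesis
  proof (cases l)
    case 0
    then have "(x + 1, 0) \<in> neighbours (comb K) v"
      using assms by (simp add: neighbours_def edges_comb verts_comb v)
    then show ?thesis by blast
  next
    case (Suc k)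
    then have "(x, k) \<in> neighbours (comb K) v"
      using assms by (simp add: neighbours_def edges_comb verts_comb v)
    then show ?thesis by blast
  qed
qed

lemma sets_cylinder: "{X :: nat \<Rightarrow> 'v. \<forall>i\<le>n. X i = p i} \<in> sets trajectories"
proof -
  have "{X \<in> space trajectories. \<forall>i\<in>{..n}. X i \<in> {p i}} \<in> sets (trajectories :: (nat \<Rightarrow> 'v) measure)"
    by (rule sets.sets_Collect_finite_All) auto
  then show ?thesis by (simp add: space_PiM Ball_def)
qed

lemma measurable_trajectory:
  fixes x :: "'v::countable"
  shows "trajectory x \<in> measurable (PiM UNIV (\<lambda>(n, v). measure_pmf (srw_step G v))) trajectories"
    (is "_ \<in> measurable ?N _")
proof (rule measurable_PiM_single')
  show "(\<lambda>\<xi>. trajectory x \<xi> n) \<in> measurable ?N (count_space UNIV)" for n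
  proof (induction n)
    case (Suc n)
    have "(\<lambda>\<xi>. \<xi> (n, v)) \<in> measurable ?N (count_space UNIV)" for v
    proof -
      have "(\<lambda>\<xi>. \<xi> (n, v)) \<in> measurable ?N (case (n, v) of (n, v) \<Rightarrow> measure_pmf (srw_step G v))"
        by (rule measurable_component_singleton) simp
      also have "\<dots> = measurable ?N (count_space UNIV)"
        by (rule measurable_cong_sets) simp_all
      finally show ?thesis .
    qed
    then have "(\<lambda>\<xi>. (\<lambda>v \<xi>. \<xi> (n, v)) (trajectory x \<xi> n) \<xi>) \<in> measurable ?N (count_space UNIV)"
      by (rule measurable_compose_countable[OF _ Suc])
    then show ?case by simp
  qed simp
qed auto

lemma simple_random_walk_srw_law:
  fixes x :: "'v::countable"
  shows "simple_random_walk G x (srw_law G x) (\<lambda>n X. X n)"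
proof -
  define S where "S = (\<lambda>(n :: nat, v). measure_pmf (srw_step G v))"
  interpret S: product_prob_space S UNIV
    by (rule product_prob_spaceI) (simp add: S_def prob_space_measure_pmf split: prod.split)
  have law: "srw_law G x = distr (PiM UNIV S) trajectories (trajectory x)"
    by (simp add: srw_law_def S_def)
  have meas: "trajectory x \<in> measurable (PiM UNIV S) trajectories"
    unfolding S_def by (rule measurable_trajectory)
  have space: "space (PiM UNIV S) = UNIV"
    by (auto simp: space_PiM S_def)
  have "measure (srw_law G x) {X \<in> space (srw_law G x). \<forall>i\<le>n. X i = p i} =
      (if p 0 = x then \<Prod>i<n. pmf (srw_step G (p i)) (p (Suc i)) else 0)" for n and p :: "nat \<Rightarrow> 'v"
  proof -
    have "measure (srw_law G x) {X \<in> space (srw_law G x). \<forall>i\<le>n. X i = p i} =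
        measure (PiM UNIV S) {\<xi>. \<forall>i\<le>n. trajectory x \<xi> i = p i}"
      using measure_distr[OF meas sets_cylinder[of n p]] space
      by (simp add: law space_PiM vimage_def)
    also have "\<dots> = (if p 0 = x then \<Prod>i<n. pmf (srw_step G (p i)) (p (Suc i)) else 0)"
    proof (cases "p 0 = x")
      case True
      let ?J = "(\<lambda>i. (i, p i)) ` {..<n}"
      have "(\<forall>i\<le>n. trajectory x \<xi> i = p i) \<longleftrightarrow> (\<forall>i<n. \<xi> (i, p i) = p (Suc i))" for \<xi>
      proof (induction n)
        case 0
        then show ?case using True by simp
      next
        case (Suc n)
        then show ?case by (auto simp: le_Suc_eq less_Suc_eq)
      qed
      then have "{\<xi>. \<forall>i\<le>n. trajectory x \<xi> i = p i} =
          {\<xi> \<in> space (PiM UNIV S). \<forall>j\<in>?J. \<xi> j \<in> {p (Suc (fst j))}}"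
        by (auto simp add: space)
      then have "emeasure (PiM UNIV S) {\<xi>. \<forall>i\<le>n. trajectory x \<xi> i = p i} =
          (\<Prod>j\<in>?J. emeasure (S j) {p (Suc (fst j))})"
        by (simp only:) (rule S.emeasure_PiM_Collect, auto simp: S_def)
      also have "\<dots> = (\<Prod>i<n. emeasure (S (i, p i)) {p (Suc i)})"
        by (subst prod.reindex) (auto simp: inj_on_def)
      also have "\<dots> = ennreal (\<Prod>i<n. pmf (srw_step G (p i)) (p (Suc i)))"
        by (simp add: S_def emeasure_pmf_single prod_ennreal)
      finally show ?thesis
        using True by (simp add: measure_def prod_nonneg)
    next
      case False
      then have "\<not> (\<forall>i\<le>n. trajectory x \<xi> i = p i)" for \<xi>
        by (metis trajectory.simps(1) zero_le)
      then have "{\<xi>. \<forall>i\<le>n. trajectory x \<xi> i = p i} = {}"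
        by blast
      then show ?thesis using False by (simp only: measure_empty if_False)
    qed
    finally show ?thesis .
  qed
  moreover have "prob_space (srw_law G x)"
    unfolding law by (rule S.P.prob_space_distr[OF meas])
  moreover have "(\<lambda>X. X n) \<in> measurable (srw_law G x) (count_space UNIV)" for n
    by (simp add: law)
  ultimately show ?thesis
    by (simp add: simple_random_walk_def)
qed

lemma simple_random_walk_measurable:
  assumes "simple_random_walk G x M X"
  shows "(\<lambda>\<omega> n. X n \<omega>) \<in> measurable M trajectories"
  using assms by (intro measurable_PiM_single') (auto simp: simple_random_walk_def)

lemma distr_simple_random_walk:
  fixes x :: "'v::countable"
  assumes X: "simple_random_walk G x M X"
  shows "distr M trajectories (\<lambda>\<omega> n. X n \<omega>) = srw_law G x"
proof -
  let ?D = "distr M trajectories (\<lambda>\<omega> n. X n \<omega>)" and ?L = "srw_law G x"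
  let ?C = "\<lambda>n p. {Y :: nat \<Rightarrow> 'v. \<forall>i\<le>n. Y i = p i}"
  have L: "simple_random_walk G x ?L (\<lambda>n X. X n)"
    by (rule simple_random_walk_srw_law)
  interpret M: prob_space M using X by (simp add: simple_random_walk_def)
  interpret L: prob_space ?L using L by (simp add: simple_random_walk_def)
  note meas = simple_random_walk_measurable[OF X]
  interpret D: prob_space ?D by (rule M.prob_space_distr[OF meas])
  have sets_L: "sets ?L = sets trajectories" by (simp add: srw_law_def)
  have space_L: "space ?L = UNIV" by (simp add: srw_law_def space_PiM)
  have C: "?C n p \<in> sets trajectories" for n and p :: "nat \<Rightarrow> 'v"
    by (rule sets_cylinder)
  have eq: "emeasure ?D (?C n p) = emeasure ?L (?C n p)" for n and p :: "nat \<Rightarrow> 'v"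
  proof -
    have "measure ?D (?C n p) = measure M {\<omega> \<in> space M. \<forall>i\<le>n. X i \<omega> = p i}"
      by (subst measure_distr[OF meas C]) (auto intro!: arg_cong[where f = "measure M"])
    also have "\<dots> = measure ?L (?C n p)"
      using X L by (simp add: simple_random_walk_def space_L)
    finally show ?thesis
      by (simp add: D.emeasure_eq_measure L.emeasure_eq_measure)
  qed
  show ?thesis
  proof (rule measure_eqI_PiM_infinite)
    fix A :: "nat \<Rightarrow> 'v set" and J :: "nat set"
    assume J: "finite J"
    then obtain n where n: "J \<subseteq> {..n}"
      using finite_nat_iff_bounded_le by auto
    define P where "P = {p \<in> PiE {..n} (\<lambda>_. UNIV). \<forall>j\<in>J. p j \<in> A j}"
    have P: "countable P"
      unfolding P_def by (rule countable_subset[OF _ countable_PiE[of "{..n}" "\<lambda>_. UNIV"]]) auto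
    have emb: "prod_emb UNIV (\<lambda>_. count_space UNIV) J (PiE J A) = (\<Union>p\<in>P. ?C n p)"
    proof (intro set_eqI iffI)
      fix Y assume Y: "Y \<in> prod_emb UNIV (\<lambda>_. count_space UNIV) J (PiE J A)"
      then have "restrict Y {..n} \<in> P"
        using n by (auto simp: P_def prod_emb_def PiE_iff restrict_def extensional_def)
      moreover have "Y \<in> ?C n (restrict Y {..n})" by simp
      ultimately show "Y \<in> (\<Union>p\<in>P. ?C n p)" by blast
    next
      fix Y assume "Y \<in> (\<Union>p\<in>P. ?C n p)"
      then show "Y \<in> prod_emb UNIV (\<lambda>_. count_space UNIV) J (PiE J A)"
        using n by (auto simp: P_def prod_emb_def PiE_iff restrict_def extensional_def)
    qed
    have disj: "disjoint_family_on (?C n) P"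
      unfolding disjoint_family_on_def
    proof (intro ballI impI)
      fix p q assume "p \<in> P" "q \<in> P" "p \<noteq> q"
      then obtain i where "i \<le> n" "p i \<noteq> q i"
        unfolding P_def by (auto simp: PiE_iff extensional_def fun_eq_iff) metis
      then show "?C n p \<inter> ?C n q = {}" by force
    qed
    show "emeasure ?D (prod_emb UNIV (\<lambda>_. count_space UNIV) J (PiE J A)) =
        emeasure ?L (prod_emb UNIV (\<lambda>_. count_space UNIV) J (PiE J A))"
      unfolding emb
      by (subst (1 2) emeasure_UN_countable[OF _ P disj])
        (use C sets_L eq in \<open>auto intro!: nn_integral_cong\<close>)
  qed (auto simp: sets_L D.finite_measure_axioms)
qed

text \<open>
  The probability that there are only finitely many collisions does not depend on how the two
  independent walks are realised.
\<close>

lemma AE_finite_collisions_iff: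
  fixes x :: "'v::countable"
  assumes X1: "simple_random_walk G x M X1" and X2: "simple_random_walk G x M X2"
    and indep: "prob_space.indep_var M trajectories (\<lambda>\<omega> n. X1 n \<omega>) trajectories (\<lambda>\<omega> n. X2 n \<omega>)"
  shows "(AE \<omega> in M. finite {n. X1 n \<omega> = X2 n \<omega>}) \<longleftrightarrow>
    (AE (Y1, Y2) in srw_law G x \<Otimes>\<^sub>M srw_law G x. finite {n. Y1 n = Y2 n})"
proof -
  interpret M: prob_space M using X1 by (simp add: simple_random_walk_def)
  let ?T = "trajectories \<Otimes>\<^sub>M trajectories :: ((nat \<Rightarrow> 'v) \<times> (nat \<Rightarrow> 'v)) measure"
  note m1 = simple_random_walk_measurable[OF X1] and m2 = simple_random_walk_measurable[OF X2]
  have law: "srw_law G x \<Otimes>\<^sub>M srw_law G x = distr M ?T (\<lambda>\<omega>. (\<lambda>n. X1 n \<omega>, \<lambda>n. X2 n \<omega>))"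
    using indep distr_simple_random_walk[OF X1] distr_simple_random_walk[OF X2]
    by (simp add: M.indep_var_distribution_eq)
  have [measurable]: "Measurable.pred ?T (\<lambda>Y. fst Y n = snd Y n)" for n
  proof -
    have "Measurable.pred ?T (\<lambda>Y. \<exists>v. fst Y n = v \<and> snd Y n = v)"
      by measurable
    then show ?thesis by (simp add: eq_commute)
  qed
  have "Measurable.pred ?T (\<lambda>Y. \<exists>N. \<forall>n. fst Y n = snd Y n \<longrightarrow> n \<le> N)"
    by measurable
  then have *: "Measurable.pred ?T (\<lambda>Y. finite {n. fst Y n = snd Y n})"
    by (simp add: finite_nat_set_iff_bounded_le)
  have pair: "(\<lambda>\<omega>. (\<lambda>n. X1 n \<omega>, \<lambda>n. X2 n \<omega>)) \<in> measurable M ?T"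
    using m1 m2 by (rule measurable_Pair)
  show ?thesis
    unfolding law case_prod_beta using AE_distr_iff[OF pair, of "\<lambda>Y. finite {n. fst Y n = snd Y n}"] *
    by (simp add: pred_def)
qed

end

theory Submission
  imports Defs "HOL-Real_Asymp.Real_Asymp"
begin

text \<open>
  Give a collision at height \<open>k\<close> the weight \<open>w = 1 / (k + 1)\<close>. Two walks that meet at height \<open>k\<close>
  stay near that height for about \<open>k\<^sup>2\<close> steps and meet about \<open>k\<close> times, so the expected weight
  of the collisions following any collision is bounded below. By the maximal inequality
  for the supermartingale of expected future weight, it therefore suffices that
  \<open>\<Sum>\<^sub>t \<Sum>\<^sub>v p\<^sub>t(0, v)\<^sup>2 w(v)\<close> is finite.

  Let \<open>\<gamma> < \<delta> < 1 / 3\<close>. By Borel-Cantelli, for all large \<open>h = 2\<^sup>i\<close> every window of length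
  \<open>l = h\<^sup>\<delta>\<close> in \<open>[- 8 h\<^sup>2, 8 h\<^sup>2]\<close> contains a tooth of height at least \<open>h\<close>. For times
  \<open>t\<close> between \<open>h\<^sup>2\<close> and \<open>4 h\<^sup>2\<close> this has two consequences, up to logarithms. (1) The heat kernel on the
  base is at most \<open>sqrt (l / h\<^sup>3)\<close>: if its maximum \<open>b\<close> were larger, its small Dirichlet energy, of order
  \<open>b / t\<close>, would keep it of order \<open>b\<close> on a base interval of length \<open>b t\<close> and on all long teeth there, and the
  total mass would exceed 1. (2) The walk spends at most time \<open>h l\<close> on the base, by a Lyapunov
  function. Hence the base contributes at most \<open>sqrt (l / h\<^sup>3) h l = h powr ((3 \<delta> - 1) / 2)\<close>,
  which is summable over \<open>i\<close>; vertices off the base are compared with the base through the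
  energy.
\<close>

section \<open>Heat kernels of reversible walks\<close>

primrec walk_pmf :: "'v graph \<Rightarrow> 'v \<Rightarrow> nat \<Rightarrow> 'v pmf" where
  "walk_pmf G x 0 = return_pmf x"
| "walk_pmf G x (Suc n) = bind_pmf (walk_pmf G x n) (srw_step G)"

lemma walk_pmf_add: "walk_pmf G x (m + n) = bind_pmf (walk_pmf G x m) (\<lambda>y. walk_pmf G y n)"
  by (induction n) (simp_all add: bind_return_pmf' bind_assoc_pmf)

lemma walk_pmf_Suc': "walk_pmf G x (Suc n) = bind_pmf (srw_step G x) (\<lambda>y. walk_pmf G y n)"
  using walk_pmf_add[of G x 1 n] by (simp add: bind_return_pmf)

locale walkable_graph =
  fixes G :: "'v graph"
  assumes finite_nb: "v \<in> verts G \<Longrightarrow> finite (neighbours G v)"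
    and nb_nonempty: "v \<in> verts G \<Longrightarrow> neighbours G v \<noteq> {}"
begin

definition deg :: "'v \<Rightarrow> real" where
  "deg v = real (card (neighbours G v))"

lemma deg_ge_1: "v \<in> verts G \<Longrightarrow> 1 \<le> deg v"
  using finite_nb[of v] nb_nonempty[of v] card_gt_0_iff[of "neighbours G v"]
  by (simp add: deg_def Suc_le_eq)

lemma nb_sym: "u \<in> verts G \<Longrightarrow> v \<in> verts G \<Longrightarrow> u \<in> neighbours G v \<longleftrightarrow> v \<in> neighbours G u"
  by (simp add: neighbours_def insert_commute)

lemma nb_verts: "neighbours G v \<subseteq> verts G"
  by (auto simp: neighbours_def)

lemma set_srw_step: "v \<in> verts G \<Longrightarrow> set_pmf (srw_step G v) = neighbours G v"
  by (simp add: srw_step_def set_pmf_of_set finite_nb nb_nonempty)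

lemma pmf_srw_step:
  "v \<in> verts G \<Longrightarrow> pmf (srw_step G v) w = (if w \<in> neighbours G v then 1 / deg v else 0)"
  by (simp add: srw_step_def pmf_of_set finite_nb nb_nonempty deg_def)

lemma set_walk_pmf:
  assumes "x \<in> verts G"
  shows "set_pmf (walk_pmf G x n) \<subseteq> verts G" "finite (set_pmf (walk_pmf G x n))"
proof -
  have "set_pmf (walk_pmf G x n) \<subseteq> verts G \<and> finite (set_pmf (walk_pmf G x n))"
  proof (induction n)
    case (Suc n)
    then show ?case
      using nb_verts set_srw_step finite_nb by (auto simp: subset_iff)
  qed (use assms in simp)
  then show "set_pmf (walk_pmf G x n) \<subseteq> verts G" "finite (set_pmf (walk_pmf G x n))"
    by auto
qed

lemma pmf_bind_finite:
  assumes "finite B" "set_pmf A \<subseteq> B"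
  shows "pmf (bind_pmf A f) v = (\<Sum>w\<in>B. pmf A w * pmf (f w) v)"
  using assms by (subst pmf_bind, subst integral_measure_pmf_real[of B]) (auto simp: mult.commute)

text \<open>One step satisfies detailed balance with respect to \<open>deg\<close>. The induction
  peels off the last step on the left and the first step on the right, the latter by
  \<open>walk_pmf_Suc'\<close>.\<close>

lemma reversible:
  assumes "x \<in> verts G" "y \<in> verts G"
  shows "deg x * pmf (walk_pmf G x n) y = deg y * pmf (walk_pmf G y n) x"
  using assms
proof (induction n arbitrary: x y)
  case (Suc n)
  \<comment> \<open>The terms on both sides vanish off this finite set, so they can be compared one
    by one.\<close>
  define B where "B = set_pmf (walk_pmf G x n) \<union> neighbours G y"
  have B: "finite B" "set_pmf (walk_pmf G x n) \<subseteq> B" "neighbours G y \<subseteq> B" "B \<subseteq> verts G"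
    using Suc set_walk_pmf[of x n] nb_verts finite_nb by (auto simp: B_def)
  have "deg x * pmf (walk_pmf G x (Suc n)) y
      = (\<Sum>w\<in>B. deg x * pmf (walk_pmf G x n) w * pmf (srw_step G w) y)"
    by (simp add: pmf_bind_finite[OF B(1,2)] sum_distrib_left mult.assoc)
  also have "\<dots> = (\<Sum>w\<in>B. deg y * (pmf (srw_step G y) w * pmf (walk_pmf G w n) x))"
  proof (rule sum.cong[OF refl])
    fix w assume "w \<in> B"
    then have w: "w \<in> verts G" using B by auto
    have "deg x * pmf (walk_pmf G x n) w * pmf (srw_step G w) y
        = pmf (walk_pmf G w n) x * (deg w * pmf (srw_step G w) y)"
      using Suc.IH[OF Suc.prems(1) w] by simp
    also have "deg w * pmf (srw_step G w) y = deg y * pmf (srw_step G y) w"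
      using w Suc.prems deg_ge_1[of w] deg_ge_1[of y] nb_sym[of w y] by (simp add: pmf_srw_step)
    finally show "deg x * pmf (walk_pmf G x n) w * pmf (srw_step G w) y
        = deg y * (pmf (srw_step G y) w * pmf (walk_pmf G w n) x)"
      by simp
  qed
  also have "\<dots> = deg y * pmf (walk_pmf G y (Suc n)) x"
    using B set_srw_step[OF Suc.prems(2)]
    by (simp add: walk_pmf_Suc' pmf_bind_finite[of B] sum_distrib_left del: walk_pmf.simps)
  finally show ?case .
qed (auto simp: pmf_return indicator_def)

text \<open>A finite sum over the support, so that unbounded \<open>\<phi>\<close> raise no question
  of integrability.\<close>

definition expect :: "'v \<Rightarrow> nat \<Rightarrow> ('v \<Rightarrow> real) \<Rightarrow> real" where
  "expect x n \<phi> = (\<Sum>v\<in>set_pmf (walk_pmf G x n). pmf (walk_pmf G x n) v * \<phi> v)"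

lemma expect_Suc:
  assumes "x \<in> verts G"
  shows "expect x (Suc n) \<phi> = expect x n (\<lambda>v. (\<Sum>w\<in>neighbours G v. \<phi> w) / deg v)"
proof -
  let ?A = "set_pmf (walk_pmf G x n)" and ?B = "set_pmf (walk_pmf G x (Suc n))"
  have A: "finite ?A" "?A \<subseteq> verts G" and B: "finite ?B"
    using set_walk_pmf[OF assms] by blast+
  have "expect x (Suc n) \<phi>
      = (\<Sum>v\<in>?B. (\<Sum>w\<in>?A. pmf (walk_pmf G x n) w * pmf (srw_step G w) v) * \<phi> v)"
    unfolding expect_def using pmf_bind_finite[OF A(1) subset_refl, of "srw_step G"] by simp
  also have "\<dots> = (\<Sum>w\<in>?A. pmf (walk_pmf G x n) w * (\<Sum>v\<in>?B. pmf (srw_step G w) v * \<phi> v))"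
    unfolding sum_distrib_right sum_distrib_left by (subst sum.swap) (simp add: ac_simps)
  also have "\<dots> = expect x n (\<lambda>v. (\<Sum>w\<in>neighbours G v. \<phi> w) / deg v)"
    unfolding expect_def
  proof (intro sum.cong refl arg_cong[where f = "(*) _"])
    fix w assume w: "w \<in> ?A"
    then have wV: "w \<in> verts G" and sub: "neighbours G w \<subseteq> ?B"
      using A set_srw_step[of w] by auto
    have "(\<Sum>v\<in>?B. pmf (srw_step G w) v * \<phi> v)
        = (\<Sum>v\<in>neighbours G w. pmf (srw_step G w) v * \<phi> v)"
      using B sub wV by (intro sum.mono_neutral_right) (auto simp: pmf_srw_step)
    then show "(\<Sum>v\<in>?B. pmf (srw_step G w) v * \<phi> v) = (\<Sum>w\<in>neighbours G w. \<phi> w) / deg w"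
      by (simp add: pmf_srw_step wV sum_divide_distrib)
  qed
  finally show ?thesis .
qed

lemma expect_mono:
  "(\<And>v. v \<in> set_pmf (walk_pmf G x n) \<Longrightarrow> \<phi> v \<le> \<psi> v) \<Longrightarrow> expect x n \<phi> \<le> expect x n \<psi>"
  unfolding expect_def by (intro sum_mono mult_left_mono) auto

lemma expect_add: "expect x n (\<lambda>v. \<phi> v + \<psi> v) = expect x n \<phi> + expect x n \<psi>"
  by (simp add: expect_def sum.distrib distrib_left)

lemma expect_const:
  assumes "x \<in> verts G"
  shows "expect x n (\<lambda>_. a) = a"
  using set_walk_pmf(2)[OF assms, of n]
  by (simp add: expect_def sum_distrib_right[symmetric] sum_pmf_eq_1)

text \<open>Foster-Lyapunov bound: the one-step inequality is averaged over the position at each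
  time and telescoped. It is required only at vertices the walk can occupy at times below
  \<open>n\<close>, so nothing is asked of \<open>\<phi>\<close> elsewhere.\<close>

lemma drift:
  assumes x: "x \<in> verts G"
    and le: "\<And>i v. i < n \<Longrightarrow> v \<in> set_pmf (walk_pmf G x i) \<Longrightarrow>
      (\<Sum>w\<in>neighbours G v. \<phi> w) / deg v + \<psi> v \<le> \<phi> v + a"
  shows "expect x n \<phi> + (\<Sum>i<n. expect x i \<psi>) \<le> \<phi> x + n * a"
  using le
proof (induction n)
  case 0
  then show ?case by (simp add: expect_def)
next
  case (Suc n)
  have "expect x (Suc n) \<phi> + expect x n \<psi> \<le> expect x n \<phi> + a"
    using expect_mono[of x n "\<lambda>v. (\<Sum>w\<in>neighbours G v. \<phi> w) / deg v + \<psi> v" "\<lambda>v. \<phi> v + a"] Suc.prems[of n]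
    by (simp add: expect_add expect_const[OF x] expect_Suc[OF x])
  moreover have "expect x n \<phi> + (\<Sum>i<n. expect x i \<psi>) \<le> \<phi> x + n * a"
    by (rule Suc.IH, rule Suc.prems) auto
  ultimately show ?case by (simp add: algebra_simps)
qed

end

section \<open>Return densities and Dirichlet energy\<close>

locale bipartite_walk = walkable_graph +
  fixes root :: 'a and colour :: "'a \<Rightarrow> bool"
  assumes root: "root \<in> verts G"
    and colour: "v \<in> verts G \<Longrightarrow> w \<in> neighbours G v \<Longrightarrow> colour w \<longleftrightarrow> \<not> colour v"
begin

text \<open>The density of the walk with respect to its reversible measure \<^term>\<open>deg\<close>.\<close>

definition hk :: "nat \<Rightarrow> 'a \<Rightarrow> real" where
  "hk n v = pmf (walk_pmf G root n) v / deg v"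

text \<open>
  The walk alternates between the two colour classes; adding two consecutive times removes this
  oscillation, so that the Dirichlet energy becomes small.
\<close>

definition hk2 :: "nat \<Rightarrow> 'a \<Rightarrow> real" where
  "hk2 n v = hk n v + hk (Suc n) v"

definition ret :: "nat \<Rightarrow> real" where
  "ret n = hk n root"

definition supp :: "nat \<Rightarrow> 'a set" where
  "supp n = set_pmf (walk_pmf G root n)"

lemma supp: "finite (supp n)" "supp n \<subseteq> verts G"
  using set_walk_pmf[OF root] by (simp_all add: supp_def)

lemma hk_eq_0: "v \<notin> supp n \<Longrightarrow> hk n v = 0"
  by (simp add: hk_def supp_def pmf_eq_0_set_pmf)

lemma hk_nonneg: "0 \<le> hk n v"
  by (simp add: hk_def deg_def)

lemma hk2_nonneg: "0 \<le> hk2 n v"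
  by (simp add: hk2_def hk_nonneg)

lemma ret_nonneg: "0 \<le> ret n"
  by (simp add: ret_def hk_nonneg)

lemma pmf_eq_hk: "pmf (walk_pmf G root n) v = deg v * hk n v"
proof (cases "v \<in> supp n")
  case True
  then show ?thesis using deg_ge_1[of v] supp(2)[of n] by (auto simp: hk_def)
qed (simp add: hk_eq_0 supp_def pmf_eq_0_set_pmf)

text \<open>Reversibility makes \<open>hk n v\<close> the probability of going from \<open>v\<close>
  to the root in \<open>n\<close> steps, divided by \<open>deg root\<close>; the sum is then
  Chapman-Kolmogorov at the root.\<close>

lemma inner:
  assumes "finite B" "B \<subseteq> verts G" "supp m \<subseteq> B"
  shows "(\<Sum>v\<in>B. deg v * (hk m v * hk n v)) = ret (m + n)"
proof -
  have "(\<Sum>v\<in>B. deg v * (hk m v * hk n v))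
      = (\<Sum>v\<in>B. pmf (walk_pmf G root m) v * pmf (walk_pmf G v n) root) / deg root"
    unfolding sum_divide_distrib
  proof (rule sum.cong[OF refl])
    fix v assume "v \<in> B"
    then have v: "v \<in> verts G" using assms by auto
    show "deg v * (hk m v * hk n v)
        = pmf (walk_pmf G root m) v * pmf (walk_pmf G v n) root / deg root"
      using reversible[OF root v, of n] deg_ge_1[OF v] deg_ge_1[OF root]
      by (simp add: hk_def field_simps)
  qed
  also have "\<dots> = ret (m + n)"
    using assms by (simp add: ret_def hk_def walk_pmf_add pmf_bind_finite[of B] supp_def)
  finally show ?thesis .
qed

text \<open>By detailed balance the density evolves by averaging over neighbours, whereas the mass
  evolves by the adjoint operator.\<close>

lemma sum_nb_hk:
  assumes v: "v \<in> verts G"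
  shows "(\<Sum>w\<in>neighbours G v. hk n w) = deg v * hk (Suc n) v"
proof -
  define B where "B = supp n \<union> neighbours G v"
  have B: "finite B" "supp n \<subseteq> B" "B \<subseteq> verts G" "neighbours G v \<subseteq> B"
    using supp[of n] finite_nb[OF v] nb_verts by (auto simp: B_def)
  have "deg v * hk (Suc n) v = (\<Sum>w\<in>B. pmf (walk_pmf G root n) w * pmf (srw_step G w) v)"
    using B deg_ge_1[OF v] by (simp add: hk_def pmf_bind_finite[of B] supp_def)
  also have "\<dots> = (\<Sum>w\<in>B. if w \<in> neighbours G v then hk n w else 0)"
    using B nb_sym v by (intro sum.cong refl) (auto simp: pmf_srw_step hk_def subset_iff)
  also have "\<dots> = (\<Sum>w\<in>neighbours G v. hk n w)"
    using B by (subst sum.inter_filter[symmetric]) (auto intro!: sum.cong)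
  finally show ?thesis by simp
qed

lemma supp_colour: "v \<in> supp n \<Longrightarrow> colour v \<longleftrightarrow> (colour root \<longleftrightarrow> even n)"
proof (induction n arbitrary: v)
  case (Suc n)
  then obtain w where "w \<in> supp n" "v \<in> neighbours G w"
    using supp(2)[of n] set_srw_step unfolding supp_def by (auto simp: subset_iff)
  then show ?case using Suc.IH[of w] colour[of w v] supp(2)[of n] by auto
qed (simp add: supp_def)

lemma hk_le_pmf: "hk n v \<le> pmf (walk_pmf G root n) v"
proof (cases "v \<in> supp n")
  case True
  then have "1 \<le> deg v" using supp(2)[of n] deg_ge_1 by auto
  then show ?thesis using hk_nonneg[of n v] by (simp add: pmf_eq_hk mult_le_cancel_right1)
qed (simp add: hk_eq_0)

lemma sum_hk2_le:
  assumes "finite B"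
  shows "(\<Sum>v\<in>B. hk2 n v) \<le> 2"
proof -
  have "(\<Sum>v\<in>B. hk m v) \<le> 1" for m
  proof -
    have "(\<Sum>v\<in>B. hk m v) \<le> (\<Sum>v\<in>B. pmf (walk_pmf G root m) v)"
      by (intro sum_mono hk_le_pmf)
    also have "\<dots> = measure (walk_pmf G root m) B"
      using assms by (simp add: measure_measure_pmf_finite)
    finally show ?thesis by (rule order_trans) (rule measure_pmf.prob_le_1)
  qed
  from this[of n] this[of "Suc n"] show ?thesis by (simp add: hk2_def sum.distrib)
qed

lemma hk2_le_2: "hk2 n v \<le> 2"
  using sum_hk2_le[of "{v}" n] by simp

lemma ret_odd: "odd n \<Longrightarrow> ret n = 0"
  unfolding ret_def using supp_colour[of root n] by (intro hk_eq_0) auto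

text \<open>Let f be \<open>hk2 t\<close> and P the averaging operator. The left side is at most 2
  <f, f - P f> with respect to \<open>deg\<close>, and f - P f is the difference of the densities at
  times \<open>t\<close> and \<open>t + 2\<close> by \<open>sum_nb_hk\<close>. Expanding with
  \<open>inner\<close> leaves only even return densities, because the odd ones vanish by
  bipartiteness.\<close>

lemma energy:
  assumes B': "finite B'" "B' \<subseteq> verts G"
  shows "(\<Sum>v\<in>B'. \<Sum>w\<in>neighbours G v. (hk2 t v - hk2 t w)\<^sup>2) \<le> 2 * (ret (2 * t) - ret (2 * t + 2))"
proof -
  define B where "B = B' \<union> (supp t \<union> supp (Suc t))"
  have B: "finite B" "B \<subseteq> verts G" "supp t \<subseteq> B" "supp (Suc t) \<subseteq> B"
    using B' supp[of t] supp[of "Suc t"] by (auto simp: B_def)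
  have g0: "hk2 t v = 0" if "v \<notin> B" for v
  proof -
    have "v \<notin> supp t" "v \<notin> supp (Suc t)" using that B by blast+
    then show ?thesis by (simp add: hk2_def hk_eq_0)
  qed
  have sum_nb_hk2: "(\<Sum>w\<in>neighbours G v. hk2 t w) = deg v * (hk (Suc t) v + hk (Suc (Suc t)) v)"
    if "v \<in> verts G" for v
    by (simp add: hk2_def sum.distrib sum_nb_hk[OF that] distrib_left)
  have "(\<Sum>v\<in>B'. \<Sum>w\<in>neighbours G v. (hk2 t v - hk2 t w)\<^sup>2)
      \<le> (\<Sum>v\<in>B. \<Sum>w\<in>neighbours G v. (hk2 t v - hk2 t w)\<^sup>2)"
    using B by (intro sum_mono2) (auto simp: B_def intro!: sum_nonneg)
  also have "\<dots> = (\<Sum>v\<in>B. deg v * (hk2 t v)\<^sup>2 + (\<Sum>w\<in>neighbours G v. (hk2 t w)\<^sup>2)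
      - 2 * (hk2 t v * (\<Sum>w\<in>neighbours G v. hk2 t w)))"
    by (intro sum.cong refl)
      (simp add: power2_diff sum.distrib sum_subtractf sum_distrib_left deg_def mult.assoc)
  also have "\<dots> = (\<Sum>v\<in>B. deg v * (hk2 t v)\<^sup>2) + (\<Sum>v\<in>B. \<Sum>w\<in>neighbours G v. (hk2 t w)\<^sup>2)
      - 2 * (\<Sum>v\<in>B. hk2 t v * (\<Sum>w\<in>neighbours G v. hk2 t w))"
    by (simp add: sum.distrib sum_subtractf sum_distrib_left)
  \<comment> \<open>Each w in \<open>B\<close> is counted once for each of its neighbours in
    \<open>B\<close>, hence at most \<open>deg w\<close> times; vertices off \<open>B\<close>
    contribute nothing.\<close>
  also have "(\<Sum>v\<in>B. \<Sum>w\<in>neighbours G v. (hk2 t w)\<^sup>2) \<le> (\<Sum>v\<in>B. deg v * (hk2 t v)\<^sup>2)"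
  proof -
    have "(\<Sum>v\<in>B. \<Sum>w\<in>neighbours G v. (hk2 t w)\<^sup>2)
        = (\<Sum>v\<in>B. \<Sum>w\<in>B. if w \<in> neighbours G v then (hk2 t w)\<^sup>2 else 0)"
    proof (rule sum.cong[OF refl])
      fix v assume "v \<in> B"
      then have "finite (neighbours G v)" using B finite_nb by auto
      then have "(\<Sum>w\<in>neighbours G v. (hk2 t w)\<^sup>2) = (\<Sum>w\<in>B \<inter> neighbours G v. (hk2 t w)\<^sup>2)"
        using g0 by (intro sum.mono_neutral_right) auto
      also have "\<dots> = (\<Sum>w\<in>B. if w \<in> neighbours G v then (hk2 t w)\<^sup>2 else 0)"
        using B by (simp add: sum.inter_restrict)
      finally show "(\<Sum>w\<in>neighbours G v. (hk2 t w)\<^sup>2)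
          = (\<Sum>w\<in>B. if w \<in> neighbours G v then (hk2 t w)\<^sup>2 else 0)" .
    qed
    also have "\<dots> = (\<Sum>w\<in>B. \<Sum>v\<in>B. if w \<in> neighbours G v then (hk2 t w)\<^sup>2 else 0)"
      by (rule sum.swap)
    also have "\<dots> \<le> (\<Sum>w\<in>B. deg w * (hk2 t w)\<^sup>2)"
    proof (rule sum_mono)
      fix w assume w: "w \<in> B"
      have "(\<Sum>v\<in>B. if w \<in> neighbours G v then (hk2 t w)\<^sup>2 else 0)
          = (\<Sum>v\<in>B \<inter> neighbours G w. (hk2 t w)\<^sup>2)"
        using B w nb_sym by (subst sum.inter_restrict) (auto intro!: sum.cong simp: subset_iff)
      also have "\<dots> \<le> (\<Sum>v\<in>neighbours G w. (hk2 t w)\<^sup>2)"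
        using w B finite_nb by (intro sum_mono2) auto
      finally show "(\<Sum>v\<in>B. if w \<in> neighbours G v then (hk2 t w)\<^sup>2 else 0) \<le> deg w * (hk2 t w)\<^sup>2"
        by (simp add: deg_def)
    qed
    finally show ?thesis .
  qed
  also have "(\<Sum>v\<in>B. hk2 t v * (\<Sum>w\<in>neighbours G v. hk2 t w))
      = (\<Sum>v\<in>B. deg v * (hk2 t v)\<^sup>2) - (\<Sum>v\<in>B. deg v * (hk2 t v * (hk t v - hk (t + 2) v)))"
    unfolding sum_subtractf[symmetric]
  proof (rule sum.cong[OF refl])
    fix v assume "v \<in> B"
    then show "hk2 t v * (\<Sum>w\<in>neighbours G v. hk2 t w)
        = deg v * (hk2 t v)\<^sup>2 - deg v * (hk2 t v * (hk t v - hk (t + 2) v))"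
      using B sum_nb_hk2[of v] by (auto simp: hk2_def power2_eq_square algebra_simps)
  qed
  also have "(\<Sum>v\<in>B. deg v * (hk2 t v * (hk t v - hk (t + 2) v)))
      = (\<Sum>v\<in>B. deg v * (hk t v * hk t v)) - (\<Sum>v\<in>B. deg v * (hk t v * hk (t + 2) v))
        + (\<Sum>v\<in>B. deg v * (hk (Suc t) v * hk t v)) - (\<Sum>v\<in>B. deg v * (hk (Suc t) v * hk (t + 2) v))"
    unfolding sum_subtractf[symmetric] sum.distrib[symmetric]
    by (intro sum.cong refl) (simp add: hk2_def algebra_simps)
  also have "\<dots> = ret (2 * t) - ret (2 * t + 2)"
    using B by (simp add: inner ret_odd mult_2)
  finally show ?thesis by simp
qed

lemma ret_decreasing: "ret (2 * t + 2) \<le> ret (2 * t)"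
  using energy[of "{}" t] by simp

lemma ret_antimono: "s \<le> t \<Longrightarrow> ret (2 * t) \<le> ret (2 * s)"
  by (rule lift_Suc_antimono_le[of "\<lambda>t. ret (2 * t)"]) (use ret_decreasing in auto)

text \<open>After (a + b)^2 \<le> 2 a^2 + 2 b^2 the two squared norms are evaluated by
  \<open>inner\<close> at equal times; the missing factor \<open>deg v\<close> is at least
  1.\<close>

lemma sum_hk2_sq_le:
  assumes "finite B"
  shows "(\<Sum>v\<in>B. (hk2 n v)\<^sup>2) \<le> 4 * ret (2 * n)"
proof -
  define B' where "B' = supp n \<union> supp (Suc n)"
  have B': "finite B'" "B' \<subseteq> verts G" "supp n \<subseteq> B'" "supp (Suc n) \<subseteq> B'"
    using supp[of n] supp[of "Suc n"] by (auto simp: B'_def)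
  have "(\<Sum>v\<in>B. (hk2 n v)\<^sup>2) \<le> (\<Sum>v\<in>B \<union> B'. (hk2 n v)\<^sup>2)"
    using assms B' by (intro sum_mono2) auto
  also have "\<dots> = (\<Sum>v\<in>B'. (hk2 n v)\<^sup>2)"
  proof (rule sum.mono_neutral_right)
    show "\<forall>v\<in>B \<union> B' - B'. (hk2 n v)\<^sup>2 = 0"
      by (auto simp: B'_def hk2_def hk_eq_0)
  qed (use assms B' in auto)
  also have "\<dots> \<le> (\<Sum>v\<in>B'. 2 * (deg v * (hk n v * hk n v)) + 2 * (deg v * (hk (Suc n) v * hk (Suc n) v)))"
  proof (rule sum_mono)
    fix v assume "v \<in> B'"
    then have d: "1 \<le> deg v" using B' deg_ge_1 by auto
    have "(hk2 n v)\<^sup>2 \<le> 2 * (hk n v * hk n v) + 2 * (hk (Suc n) v * hk (Suc n) v)"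
      using sum_squares_bound[of "hk n v" "hk (Suc n) v"]
      by (simp add: hk2_def power2_eq_square algebra_simps)
    also have "\<dots> \<le> 2 * (deg v * (hk n v * hk n v)) + 2 * (deg v * (hk (Suc n) v * hk (Suc n) v))"
      using mult_right_mono[OF d, of "hk n v * hk n v"]
        mult_right_mono[OF d, of "hk (Suc n) v * hk (Suc n) v"] by simp
    finally show "(hk2 n v)\<^sup>2 \<le> 2 * (deg v * (hk n v * hk n v)) + 2 * (deg v * (hk (Suc n) v * hk (Suc n) v))" .
  qed
  also have "\<dots> = 2 * ret (n + n) + 2 * ret (Suc n + Suc n)"
    by (simp only: sum.distrib sum_distrib_left[symmetric] inner[OF B'(1-3)] inner[OF B'(1,2,4)])
  also have "\<dots> \<le> 4 * ret (2 * n)"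
    using ret_antimono[of n "n + 1"] by (simp only: mult_2) simp
  finally show ?thesis .
qed

section \<open>Logarithmic convexity of the return densities\<close>

lemma ret_0: "0 < ret 0" "ret 0 \<le> 1"
  using deg_ge_1[OF root] by (auto simp: ret_def hk_def)

text \<open>Cauchy-Schwarz for the form in \<open>inner\<close>, applied to the densities at times
  \<open>t\<close> and \<open>t + 2\<close>.\<close>

lemma ret_log_convex: "(ret (2 * t + 2))\<^sup>2 \<le> ret (2 * t) * ret (2 * t + 4)"
proof -
  define B where "B = supp t \<union> supp (t + 2)"
  have B: "finite B" "B \<subseteq> verts G" "supp t \<subseteq> B" "supp (t + 2) \<subseteq> B"
    using supp[of t] supp[of "t + 2"] by (auto simp: B_def)
  have "(\<Sum>v\<in>B. (sqrt (deg v) * hk t v) * (sqrt (deg v) * hk (t + 2) v))\<^sup>2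
      \<le> (\<Sum>v\<in>B. (sqrt (deg v) * hk t v)\<^sup>2) * (\<Sum>v\<in>B. (sqrt (deg v) * hk (t + 2) v)\<^sup>2)"
    by (rule Cauchy_Schwarz_ineq_sum)
  moreover have "(sqrt (deg v) * a) * (sqrt (deg v) * b) = deg v * (a * b)"
      "(sqrt (deg v) * a)\<^sup>2 = deg v * (a * a)" for v a b
    by (simp_all add: deg_def power2_eq_square algebra_simps)
  ultimately have "(ret (t + (t + 2)))\<^sup>2 \<le> ret (t + t) * ret (t + 2 + (t + 2))"
    by (simp only: inner[OF B(1-3), of t] inner[OF B(1-3), of "t + 2"]
        inner[OF B(1,2,4), of "t + 2"])
  moreover have "t + (t + 2) = 2 * t + 2" "t + t = 2 * t" "t + 2 + (t + 2) = 2 * t + 4"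
    by simp_all
  ultimately show ?thesis
    by (simp only:)
qed

text \<open>\<open>ret (2 * t)\<close> is the squared norm of the density at time \<open>t\<close>,
  which is not identically zero.\<close>

lemma ret_pos: "0 < ret (2 * t)"
proof (rule ccontr)
  assume "\<not> 0 < ret (2 * t)"
  then have "ret (t + t) = 0" using ret_nonneg[of "2 * t"] by (simp add: mult_2)
  then have "(\<Sum>v\<in>supp t. deg v * (hk t v * hk t v)) = 0"
    using inner[of "supp t" t t] supp[of t] by simp
  then have 0: "deg v * (hk t v * hk t v) = 0" if "v \<in> supp t" for v
    using that supp[of t] hk_nonneg
    by (subst (asm) sum_nonneg_eq_0_iff) (auto simp: deg_def)
  obtain v where v: "v \<in> supp t"
    using set_pmf_not_empty[of "walk_pmf G root t"] by (auto simp: supp_def)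
  have "pmf (walk_pmf G root t) v = 0"
    using 0[OF v] by (auto simp: pmf_eq_hk)
  then show False using v by (simp add: supp_def set_pmf_iff)
qed

text \<open>A convex sequence at \<open>t\<close> lies below its chord from 0 to
  \<open>t + 1\<close>. This is that inequality for the logarithm of \<open>ret (2 * t)\<close>,
  written with powers.\<close>

lemma ret_power: "ret (2 * t) ^ (t + 1) \<le> ret (2 * t + 2) ^ t * ret 0"
proof (induction t)
  case (Suc t)
  let ?a = "ret (2 * t)" and ?b = "ret (2 * t + 2)" and ?c = "ret (2 * t + 4)"
  have pos: "0 < ?b" using ret_pos[of "t + 1"] by simp
  have "?b ^ t * ?b ^ (t + 2) = (?b\<^sup>2) ^ (t + 1)"
    unfolding power_add[symmetric] power_mult[symmetric]
    by (rule arg_cong[where f = "power _"]) simp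
  also have "\<dots> \<le> (?a * ?c) ^ (t + 1)"
    using ret_log_convex by (intro power_mono) auto
  also have "\<dots> = ?a ^ (t + 1) * ?c ^ (t + 1)"
    by (rule power_mult_distrib)
  also have "\<dots> \<le> (?b ^ t * ret 0) * ?c ^ (t + 1)"
    using Suc by (intro mult_right_mono) (auto simp: ret_nonneg)
  finally have "?b ^ t * ?b ^ (t + 2) \<le> ?b ^ t * (?c ^ (t + 1) * ret 0)"
    by (simp add: ac_simps)
  then have "?b ^ (t + 2) \<le> ?c ^ (t + 1) * ret 0"
    using pos by simp
  moreover have "2 * Suc t = 2 * t + 2" "2 * t + 2 + 2 = 2 * t + 4" "Suc t + 1 = t + 2" "Suc t = t + 1"
    by simp_all
  ultimately show ?case by (simp only:)
qed simp

text \<open>An elementary substitute for a spectral estimate. With a and b the values at times 2 t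
  and 2 t + 2, \<open>ret_power\<close> and \<open>ret 0 \<le> 1\<close> give a \<le> (b / a)^t;
  then take logarithms and use ln y \<le> y - 1.\<close>

lemma decrement: "t * (ret (2 * t) - ret (2 * t + 2)) \<le> ret (2 * t) * ln (1 / ret (2 * t))"
proof -
  let ?a = "ret (2 * t)" and ?b = "ret (2 * t + 2)"
  have pos: "0 < ?a" "0 < ?b" using ret_pos[of t] ret_pos[of "t + 1"] by simp_all
  have "?a ^ t * ?a \<le> ?b ^ t * 1"
    using ret_power[of t] ret_0 pos by (auto simp: mult.commute intro: order_trans mult_left_mono)
  then have "?a \<le> (?b / ?a) ^ t"
    using pos by (simp add: power_divide field_simps)
  then have "ln ?a \<le> t * ln (?b / ?a)"
    using pos by (metis ln_le_cancel_iff ln_realpow zero_less_divide_iff zero_less_power)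
  also have "\<dots> \<le> t * (?b / ?a - 1)"
    using pos by (intro mult_left_mono ln_le_minus_one) auto
  finally show ?thesis
    using pos by (simp add: ln_div field_simps)
qed

text \<open>
  The case \<^prop>\<open>ret (2 * t) \<le> 1 / t\<^sup>2\<close> is trivial, and otherwise the logarithm in \<open>decrement\<close> is at
  most \<open>2 ln t\<close>.
\<close>

lemma decrement_bound:
  assumes t: "3 \<le> t" and b: "ret (2 * t) \<le> b" "1 / t \<le> b"
  shows "ret (2 * t) - ret (2 * t + 2) \<le> 2 * b * ln t / t"
proof -
  let ?a = "ret (2 * t)"
  have lnt: "1 \<le> ln (real t)"
    using t exp_le by (subst ln_ge_iff) auto
  have b0: "0 < b" using t b(2) by (auto intro: less_le_trans[rotated])
  show ?thesis
  proof (cases "?a \<le> 1 / t\<^sup>2")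
    case True
    have "?a - ret (2 * t + 2) \<le> 1 / t * (1 / t)"
      using True ret_nonneg[of "2 * t + 2"] by (simp add: power2_eq_square)
    also have "\<dots> \<le> b * (1 / t)" using b by (intro mult_right_mono) auto
    also have "\<dots> \<le> 2 * b * ln t / t"
      using lnt b0 t by (simp add: field_simps)
    finally show ?thesis .
  next
    case False
    then have "1 / ?a \<le> real t ^ 2"
      using t ret_pos[of t] by (simp add: field_simps)
    then have "ln (1 / ?a) \<le> ln (real t ^ 2)"
      using ret_pos[of t] by (intro ln_mono) auto
    also have "\<dots> = 2 * ln t" using t by (simp add: ln_realpow)
    finally have "t * (?a - ret (2 * t + 2)) \<le> ?a * (2 * ln t)"
      using decrement[of t] ret_pos[of t] by (meson mult_left_mono order_trans less_imp_le)
    also have "\<dots> \<le> b * (2 * ln t)"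
      using b lnt by (intro mult_right_mono) auto
    finally show ?thesis using t by (simp add: field_simps)
  qed
qed

text \<open>One of \<open>t\<close> and \<open>t + 1\<close> is even and at most 2 t. The return
  density at that time is a summand of \<open>hk2 t root\<close> and dominates
  \<open>ret (2 * t)\<close> by monotonicity along even times.\<close>

lemma ret_le_hk2_root:
  assumes "1 \<le> t" shows "ret (2 * t) \<le> hk2 t root"
proof -
  have "ret (2 * t) \<le> ret (2 * ((t + 1) div 2))"
    using assms by (intro ret_antimono) auto
  also have "\<dots> \<le> hk2 t root"
    using hk_nonneg[of t root] hk_nonneg[of "Suc t" root]
    by (cases "even t") (auto simp: hk2_def ret_def)
  finally show ?thesis .
qed

end

section \<open>From expected weighted collisions to finitely many collisions\<close>

text \<open>The transition law is stated as a product formula for cylinders, so that histories of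
  probability zero need no separate treatment.\<close>

locale markov_process =
  fixes M :: "'w measure" and Z :: "nat \<Rightarrow> 'w \<Rightarrow> 's::countable" and Q :: "'s \<Rightarrow> 's pmf" and z0 :: 's
  assumes measurable_Z [measurable]: "Z n \<in> measurable M (count_space UNIV)"
    and prob_space_M: "prob_space M"
    and start: "AE \<omega> in M. Z 0 \<omega> = z0"
    and step: "emeasure M {\<omega> \<in> space M. \<forall>i\<le>Suc n. Z i \<omega> = p i} =
      emeasure M {\<omega> \<in> space M. \<forall>i\<le>n. Z i \<omega> = p i} * pmf (Q (p n)) (p (Suc n))"
begin

sublocale prob_space M by (rule prob_space_M)

lemma markov_cylinder:
  "(\<integral>\<^sup>+\<omega>. \<phi> (Z (Suc n) \<omega>) * indicator {\<omega> \<in> space M. \<forall>i\<le>n. Z i \<omega> = p i} \<omega> \<partial>M) =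
     (\<integral>\<^sup>+s. \<phi> s \<partial>Q (p n)) * emeasure M {\<omega> \<in> space M. \<forall>i\<le>n. Z i \<omega> = p i}"
    (is "?L = _ * emeasure M ?C")
proof -
  have [measurable]: "?C \<in> sets M" by measurable
  have cyl: "emeasure M {\<omega> \<in> ?C. Z (Suc n) \<omega> = s} = emeasure M ?C * pmf (Q (p n)) s" for s
  proof -
    let ?q = "p(Suc n := s)"
    have "{\<omega> \<in> ?C. Z (Suc n) \<omega> = s} = {\<omega> \<in> space M. \<forall>i\<le>Suc n. Z i \<omega> = ?q i}"
      by (auto simp: le_Suc_eq)
    also have "emeasure M \<dots> = emeasure M {\<omega> \<in> space M. \<forall>i\<le>n. Z i \<omega> = ?q i} * pmf (Q (p n)) s"
      by (subst step) simp
    also have "{\<omega> \<in> space M. \<forall>i\<le>n. Z i \<omega> = ?q i} = ?C"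
      by auto
    finally show ?thesis .
  qed
  have "?L = (\<integral>\<^sup>+\<omega>. (\<integral>\<^sup>+s. \<phi> s * indicator {\<omega> \<in> ?C. Z (Suc n) \<omega> = s} \<omega>
      \<partial>count_space UNIV) \<partial>M)"
  proof (rule nn_integral_cong)
    fix \<omega> assume "\<omega> \<in> space M"
    have "(\<integral>\<^sup>+s. \<phi> s * indicator {\<omega> \<in> ?C. Z (Suc n) \<omega> = s} \<omega> \<partial>count_space UNIV)
        = (\<integral>\<^sup>+s. (\<phi> s * indicator ?C \<omega>) * indicator {Z (Suc n) \<omega>} s \<partial>count_space UNIV)"
      by (intro nn_integral_cong) (auto simp: indicator_def)
    also have "\<dots> = \<phi> (Z (Suc n) \<omega>) * indicator ?C \<omega>"
      by (subst nn_integral_indicator_singleton) (auto simp: one_ennreal_def[symmetric])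
    finally show "\<phi> (Z (Suc n) \<omega>) * indicator ?C \<omega>
        = (\<integral>\<^sup>+s. \<phi> s * indicator {\<omega> \<in> ?C. Z (Suc n) \<omega> = s} \<omega> \<partial>count_space UNIV)"
      by simp
  qed
  also have "\<dots> = (\<integral>\<^sup>+s. (\<integral>\<^sup>+\<omega>. \<phi> s * indicator {\<omega> \<in> ?C. Z (Suc n) \<omega> = s} \<omega> \<partial>M)
      \<partial>count_space UNIV)"
    by (rule nn_integral_count_space_nn_integral) auto
  also have "\<dots> = (\<integral>\<^sup>+s. ennreal (pmf (Q (p n)) s) * \<phi> s * emeasure M ?C \<partial>count_space UNIV)"
  proof (rule nn_integral_cong)
    fix s
    have "(\<integral>\<^sup>+\<omega>. \<phi> s * indicator {\<omega> \<in> ?C. Z (Suc n) \<omega> = s} \<omega> \<partial>M)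
        = \<phi> s * emeasure M {\<omega> \<in> ?C. Z (Suc n) \<omega> = s}"
      by (rule nn_integral_cmult_indicator) measurable
    then show "(\<integral>\<^sup>+\<omega>. \<phi> s * indicator {\<omega> \<in> ?C. Z (Suc n) \<omega> = s} \<omega> \<partial>M)
        = ennreal (pmf (Q (p n)) s) * \<phi> s * emeasure M ?C"
      by (simp only: cyl) (simp add: ac_simps)
  qed
  also have "\<dots> = (\<integral>\<^sup>+s. \<phi> s \<partial>Q (p n)) * emeasure M ?C"
    by (simp add: nn_integral_multc nn_integral_measure_pmf)
  finally show ?thesis .
qed

text \<open>The history up to time \<open>n\<close> takes countably many values, so both integrals
  split over cylinders, where \<open>markov_cylinder\<close> applies. The assumption on
  \<open>\<psi>\<close> makes it constant on each cylinder.\<close>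

lemma markov:
  assumes \<psi>: "\<And>X Y. (\<And>i. i \<le> n \<Longrightarrow> X i = Y i) \<Longrightarrow> \<psi> X = \<psi> Y"
  shows "(\<integral>\<^sup>+\<omega>. \<psi> (\<lambda>i. Z i \<omega>) * \<phi> (Z (Suc n) \<omega>) \<partial>M) =
     (\<integral>\<^sup>+\<omega>. \<psi> (\<lambda>i. Z i \<omega>) * (\<integral>\<^sup>+s. \<phi> s \<partial>Q (Z n \<omega>)) \<partial>M)"
proof -
  define P :: "(nat \<Rightarrow> 's) set" where "P = PiE {..n} (\<lambda>_. UNIV)"
  have P: "countable P"
    unfolding P_def by (rule countable_PiE) auto
  define C where "C p = {\<omega> \<in> space M. \<forall>i\<le>n. Z i \<omega> = p i}" for p
  have C [measurable]: "C p \<in> sets M" for p unfolding C_def by measurable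
  have split: "(\<integral>\<^sup>+\<omega>. \<psi> (\<lambda>i. Z i \<omega>) * h \<omega> \<partial>M) =
      (\<integral>\<^sup>+p. \<psi> p * (\<integral>\<^sup>+\<omega>. h \<omega> * indicator (C p) \<omega> \<partial>M) \<partial>count_space P)"
    if [measurable]: "h \<in> borel_measurable M" for h
  proof -
    have "(\<integral>\<^sup>+\<omega>. \<psi> (\<lambda>i. Z i \<omega>) * h \<omega> \<partial>M) =
        (\<integral>\<^sup>+\<omega>. (\<integral>\<^sup>+p. \<psi> p * (h \<omega> * indicator (C p) \<omega>) \<partial>count_space P) \<partial>M)"
    proof (rule nn_integral_cong)
      fix \<omega> assume \<omega>: "\<omega> \<in> space M"
      define q where "q = restrict (\<lambda>i. Z i \<omega>) {..n}"
      have q: "q \<in> P" by (auto simp: q_def P_def)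
      have "\<omega> \<in> C p \<longleftrightarrow> p = q" if "p \<in> P" for p
        using that \<omega> by (auto simp: C_def q_def P_def PiE_iff extensional_def fun_eq_iff restrict_def)
      then have "(\<integral>\<^sup>+p. \<psi> p * (h \<omega> * indicator (C p) \<omega>) \<partial>count_space P)
          = (\<integral>\<^sup>+p. \<psi> p * h \<omega> * indicator {q} p \<partial>count_space P)"
        by (intro nn_integral_cong) (auto simp: indicator_def)
      also have "\<dots> = \<psi> q * h \<omega>"
        using q by (subst nn_integral_indicator_singleton) (auto simp: one_ennreal_def[symmetric])
      also have "\<psi> q = \<psi> (\<lambda>i. Z i \<omega>)"
        by (rule \<psi>) (simp add: q_def)
      finally show "\<psi> (\<lambda>i. Z i \<omega>) * h \<omega> =
          (\<integral>\<^sup>+p. \<psi> p * (h \<omega> * indicator (C p) \<omega>) \<partial>count_space P)"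
        by simp
    qed
    also have "\<dots> = (\<integral>\<^sup>+p. (\<integral>\<^sup>+\<omega>. \<psi> p * (h \<omega> * indicator (C p) \<omega>) \<partial>M) \<partial>count_space P)"
      by (rule nn_integral_count_space_nn_integral[OF P]) auto
    also have "\<dots> = (\<integral>\<^sup>+p. \<psi> p * (\<integral>\<^sup>+\<omega>. h \<omega> * indicator (C p) \<omega> \<partial>M) \<partial>count_space P)"
      by (intro nn_integral_cong nn_integral_cmult) auto
    finally show ?thesis .
  qed
  have "(\<integral>\<^sup>+\<omega>. \<phi> (Z (Suc n) \<omega>) * indicator (C p) \<omega> \<partial>M)
      = (\<integral>\<^sup>+\<omega>. (\<integral>\<^sup>+s. \<phi> s \<partial>Q (Z n \<omega>)) * indicator (C p) \<omega> \<partial>M)" for p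
  proof -
    have "(\<integral>\<^sup>+\<omega>. (\<integral>\<^sup>+s. \<phi> s \<partial>Q (Z n \<omega>)) * indicator (C p) \<omega> \<partial>M)
        = (\<integral>\<^sup>+\<omega>. (\<integral>\<^sup>+s. \<phi> s \<partial>Q (p n)) * indicator (C p) \<omega> \<partial>M)"
      by (intro nn_integral_cong) (auto simp: C_def indicator_def)
    also have "\<dots> = (\<integral>\<^sup>+s. \<phi> s \<partial>Q (p n)) * emeasure M (C p)"
      by (rule nn_integral_cmult_indicator) (rule C)
    finally show ?thesis
      using markov_cylinder[of \<phi> n p] by (simp add: C_def)
  qed
  then show ?thesis
    by (subst (1 2) split) auto
qed

lemma markov':
  "(\<integral>\<^sup>+\<omega>. \<phi> (Z (Suc n) \<omega>) \<partial>M) = (\<integral>\<^sup>+\<omega>. (\<integral>\<^sup>+s. \<phi> s \<partial>Q (Z n \<omega>)) \<partial>M)"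
  using markov[of n "\<lambda>_. 1" \<phi>] by simp

lemma maximal_inequality:
  assumes super: "\<And>z. (\<integral>\<^sup>+s. H s \<partial>Q z) \<le> H z" and D: "\<And>z. z \<in> D \<Longrightarrow> c \<le> H z"
  shows "c * emeasure M {\<omega> \<in> space M. \<exists>n\<ge>N. Z n \<omega> \<in> D} \<le> (\<integral>\<^sup>+\<omega>. H (Z N \<omega>) \<partial>M)"
proof -
  \<comment> \<open>Time \<open>n\<close> itself is left out, so that membership in
    \<open>A (Suc n)\<close> is decided by the history up to time \<open>n\<close> and
    \<open>markov\<close> applies to the next step.\<close>
  define A where "A n = {X. \<forall>i. N \<le> i \<and> i < n \<longrightarrow> X i \<notin> D}" for n
  define J where "J n \<omega> = c * indicator (- A n) (\<lambda>i. Z i \<omega>) + indicator (A n) (\<lambda>i. Z i \<omega>) * H (Z n \<omega>)"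
    for n \<omega>
  have [measurable]: "(\<lambda>\<omega>. indicator (A n) (\<lambda>i. Z i \<omega>) :: ennreal) \<in> borel_measurable M"
      "(\<lambda>\<omega>. indicator (- A n) (\<lambda>i. Z i \<omega>) :: ennreal) \<in> borel_measurable M" for n
    unfolding A_def indicator_def by measurable
  have J: "(\<integral>\<^sup>+\<omega>. J n \<omega> \<partial>M) \<le> (\<integral>\<^sup>+\<omega>. H (Z N \<omega>) \<partial>M)" if "N \<le> n" for n
    using that
  proof (induction n rule: dec_induct)
    case base
    have "A N = UNIV" by (auto simp: A_def)
    then show ?case by (simp add: J_def)
  next
    case (step n)
    have eq: "(\<integral>\<^sup>+\<omega>. indicator (A (Suc n)) (\<lambda>i. Z i \<omega>) * H (Z (Suc n) \<omega>) \<partial>M)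
        = (\<integral>\<^sup>+\<omega>. indicator (A (Suc n)) (\<lambda>i. Z i \<omega>) * (\<integral>\<^sup>+s. H s \<partial>Q (Z n \<omega>)) \<partial>M)"
      by (rule markov) (auto simp: A_def indicator_def)
    have "(\<integral>\<^sup>+\<omega>. J (Suc n) \<omega> \<partial>M) = (\<integral>\<^sup>+\<omega>. c * indicator (- A (Suc n)) (\<lambda>i. Z i \<omega>) +
        indicator (A (Suc n)) (\<lambda>i. Z i \<omega>) * (\<integral>\<^sup>+s. H s \<partial>Q (Z n \<omega>)) \<partial>M)"
      unfolding J_def by (subst (1 2) nn_integral_add) (auto simp: eq)
    also have "\<dots> \<le> (\<integral>\<^sup>+\<omega>. J n \<omega> \<partial>M)"
    proof (rule nn_integral_mono)
      fix \<omega>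
      have A_Suc: "(\<lambda>i. Z i \<omega>) \<in> A (Suc n) \<longleftrightarrow> (\<lambda>i. Z i \<omega>) \<in> A n \<and> Z n \<omega> \<notin> D"
        using step.hyps by (auto simp: A_def less_Suc_eq)
      show "c * indicator (- A (Suc n)) (\<lambda>i. Z i \<omega>) +
          indicator (A (Suc n)) (\<lambda>i. Z i \<omega>) * (\<integral>\<^sup>+s. H s \<partial>Q (Z n \<omega>)) \<le> J n \<omega>"
        using super[of "Z n \<omega>"] D[of "Z n \<omega>"] by (auto simp: J_def indicator_def A_Suc)
    qed
    finally show ?case using step.IH by simp
  qed
  define E where "E n = {\<omega> \<in> space M. \<exists>i. N \<le> i \<and> i < n \<and> Z i \<omega> \<in> D}" for n
  have E [measurable]: "E n \<in> sets M" for n unfolding E_def by measurable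
  have bound: "c * emeasure M (E n) \<le> (\<integral>\<^sup>+\<omega>. H (Z N \<omega>) \<partial>M)" for n
  proof (cases "N \<le> n")
    case True
    have "c * emeasure M (E n) = (\<integral>\<^sup>+\<omega>. c * indicator (E n) \<omega> \<partial>M)"
      by (simp add: nn_integral_cmult_indicator)
    also have "\<dots> \<le> (\<integral>\<^sup>+\<omega>. J n \<omega> \<partial>M)"
      by (intro nn_integral_mono) (auto simp: J_def E_def A_def indicator_def)
    finally show ?thesis using J[OF True] by simp
  next
    case False
    then have "E n = {}" by (auto simp: E_def)
    then show ?thesis by simp
  qed
  have "{\<omega> \<in> space M. \<exists>n\<ge>N. Z n \<omega> \<in> D} = (\<Union>n. E n)"
    by (auto simp: E_def)
  moreover have "(SUP n. emeasure M (E n)) = emeasure M (\<Union>n. E n)"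
    by (rule SUP_emeasure_incseq) (auto simp: E_def incseq_def)
  ultimately have "c * emeasure M {\<omega> \<in> space M. \<exists>n\<ge>N. Z n \<omega> \<in> D} = (SUP n. c * emeasure M (E n))"
    by (simp only: SUP_mult_left_ennreal[symmetric])
  then show ?thesis
    using bound by (simp add: SUP_least)
qed

end

section \<open>Collisions of two independent walks\<close>

lemma pmf_pair': "pmf (pair_pmf A B) z = pmf A (fst z) * pmf B (snd z)"
  using pmf_pair[of A B "fst z" "snd z"] by simp

lemma pair_pmf_bind:
  "bind_pmf (pair_pmf A B) (\<lambda>(a, b). pair_pmf (F a) (H b)) = pair_pmf (bind_pmf A F) (bind_pmf B H)"
  unfolding pair_pmf_def
  by (simp add: bind_assoc_pmf bind_return_pmf) (subst (2) bind_commute_pmf, simp)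

context
  fixes G :: "'v::countable graph" and w :: "'v \<Rightarrow> ennreal"
begin

text \<open>The expected weight of a collision at time \<open>n\<close> of independent walks started
  at the two entries of \<open>z\<close>; positions that differ count 0.\<close>

definition coll :: "nat \<Rightarrow> 'v \<times> 'v \<Rightarrow> ennreal" where
  "coll n z = (\<integral>\<^sup>+y. w (fst y) * indicator {y. fst y = snd y} y
      \<partial>pair_pmf (walk_pmf G (fst z) n) (walk_pmf G (snd z) n))"

definition pair_step :: "'v \<times> 'v \<Rightarrow> ('v \<times> 'v) pmf" where
  "pair_step z = pair_pmf (srw_step G (fst z)) (srw_step G (snd z))"

lemma coll_Suc: "(\<integral>\<^sup>+y. coll n y \<partial>pair_step z) = coll (Suc n) z"
proof -
  have "pair_pmf (walk_pmf G (fst z) (Suc n)) (walk_pmf G (snd z) (Suc n))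
      = bind_pmf (pair_step z) (\<lambda>(a, b). pair_pmf (walk_pmf G a n) (walk_pmf G b n))"
    unfolding walk_pmf_Suc' pair_step_def by (rule pair_pmf_bind[symmetric])
  then show ?thesis
    by (simp add: coll_def nn_integral_bind_pmf case_prod_beta del: walk_pmf.simps)
qed

lemma coll_diag: "coll n (v, v) = (\<integral>\<^sup>+y. ennreal ((pmf (walk_pmf G v n) y)\<^sup>2) * w y \<partial>count_space UNIV)"
proof -
  let ?p = "pmf (walk_pmf G v n)"
  have "coll n (v, v) = (\<integral>\<^sup>+y. \<integral>\<^sup>+y'. w y * indicator {y} y' \<partial>walk_pmf G v n \<partial>walk_pmf G v n)"
    unfolding coll_def by (simp add: nn_integral_pair_pmf' indicator_def)
      (intro nn_integral_cong, auto intro!: nn_integral_cong)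
  also have "\<dots> = (\<integral>\<^sup>+y. w y * ennreal (?p y) \<partial>walk_pmf G v n)"
    by (simp add: nn_integral_cmult_indicator emeasure_pmf_single)
  also have "\<dots> = (\<integral>\<^sup>+y. ennreal ((?p y)\<^sup>2) * w y \<partial>count_space UNIV)"
    by (simp add: nn_integral_measure_pmf power2_eq_square ennreal_mult ac_simps)
  finally show ?thesis .
qed

text \<open>The total weight expected from \<open>z\<close> on is superharmonic in \<open>z\<close>
  and at least \<open>c\<close> on the diagonal. The maximal inequality therefore bounds
  \<open>c\<close> times the probability of a collision at or after time \<open>N\<close> by a tail
  of the convergent series.\<close>

lemma finite_collisions:
  assumes fin: "(\<Sum>n. coll n (x, x)) < \<top>" and c: "0 < c"
    and lower: "\<And>v. c \<le> (\<Sum>n. coll n (v, v))"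
  shows "AE (X1, X2) in srw_law G x \<Otimes>\<^sub>M srw_law G x. finite {n. X1 n = X2 n}"
proof -
  let ?L = "srw_law G x"
  interpret L: prob_space ?L
    using simple_random_walk_srw_law[of G x] by (simp add: simple_random_walk_def)
  interpret LL: pair_prob_space ?L ?L ..
  have [measurable_cong]: "sets ?L = sets trajectories" by (simp add: srw_law_def)
  have space_L: "space ?L = UNIV" by (simp add: srw_law_def space_PiM)
  have cyl: "emeasure ?L {X. \<forall>i\<le>n. X i = p i} =
      ennreal (if p 0 = x then \<Prod>i<n. pmf (srw_step G (p i)) (p (Suc i)) else 0)" for n p
    using simple_random_walk_srw_law[of G x]
    by (simp add: simple_random_walk_def space_L L.emeasure_eq_measure)
  have cyl_sets: "{X. \<forall>i\<le>n. X i = p i} \<in> sets ?L" for n and p :: "nat \<Rightarrow> 'v"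
    using sets_cylinder[of n p] by (simp add: srw_law_def)
  define Z where "Z n \<omega> = (fst \<omega> n, snd \<omega> n)" for n and \<omega> :: "(nat \<Rightarrow> 'v) \<times> (nat \<Rightarrow> 'v)"
  have Z_cyl: "emeasure (?L \<Otimes>\<^sub>M ?L) {\<omega> \<in> space (?L \<Otimes>\<^sub>M ?L). \<forall>i\<le>n. Z i \<omega> = p i} =
      emeasure ?L {X. \<forall>i\<le>n. X i = fst (p i)} * emeasure ?L {X. \<forall>i\<le>n. X i = snd (p i)}" for n p
  proof -
    have "{\<omega> \<in> space (?L \<Otimes>\<^sub>M ?L). \<forall>i\<le>n. Z i \<omega> = p i} =
        {X. \<forall>i\<le>n. X i = fst (p i)} \<times> {X. \<forall>i\<le>n. X i = snd (p i)}"
      by (auto simp: Z_def space_pair_measure space_L prod_eq_iff)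
    then show ?thesis using cyl_sets by (simp add: L.emeasure_pair_measure_Times)
  qed
  have Zm: "Z n \<in> measurable (?L \<Otimes>\<^sub>M ?L) (count_space UNIV)" for n
  proof -
    have "Z n \<in> measurable (?L \<Otimes>\<^sub>M ?L) (count_space UNIV \<Otimes>\<^sub>M count_space UNIV)"
      unfolding Z_def by measurable
    then show ?thesis
      by (simp add: pair_measure_countable)
  qed
  interpret Z: markov_process "?L \<Otimes>\<^sub>M ?L" Z pair_step "(x, x)"
  proof
    show "AE \<omega> in ?L \<Otimes>\<^sub>M ?L. Z 0 \<omega> = (x, x)"
    proof (rule LL.P.AE_I_eq_1)
      show "emeasure (?L \<Otimes>\<^sub>M ?L) {\<omega> \<in> space (?L \<Otimes>\<^sub>M ?L). Z 0 \<omega> = (x, x)} = 1"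
        using Z_cyl[of 0 "\<lambda>_. (x, x)"] cyl[of 0 "\<lambda>_. x"] by simp
      show "{\<omega> \<in> space (?L \<Otimes>\<^sub>M ?L). Z 0 \<omega> = (x, x)} \<in> sets (?L \<Otimes>\<^sub>M ?L)"
        using Zm[of 0] by measurable
    qed
  qed (use Zm in \<open>auto simp: Z_cyl cyl pair_step_def pmf_pair' ennreal_mult[symmetric] prod_nonneg
      LL.P.prob_space_axioms\<close>)
  define H where "H z = (\<Sum>n. coll n z)" for z
  \<comment> \<open>Averaging over one step shifts the series, so that exactly its first term is
    lost.\<close>
  have super: "(\<integral>\<^sup>+s. H s \<partial>pair_step z) = (\<Sum>n. coll (Suc n) z)" for z
    unfolding H_def by (subst nn_integral_suminf) (auto simp: coll_Suc)
  have Z_coll: "(\<integral>\<^sup>+\<omega>. coll n (Z N \<omega>) \<partial>(?L \<Otimes>\<^sub>M ?L)) = coll (n + N) (x, x)" for n N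
  proof (induction N arbitrary: n)
    case 0
    have "(\<integral>\<^sup>+\<omega>. coll n (Z 0 \<omega>) \<partial>(?L \<Otimes>\<^sub>M ?L)) = (\<integral>\<^sup>+\<omega>. coll n (x, x) \<partial>(?L \<Otimes>\<^sub>M ?L))"
      using Z.start by (intro nn_integral_cong_AE) auto
    then show ?case by (simp add: LL.P.emeasure_space_1)
  next
    case (Suc N)
    then show ?case
      using Suc[of "Suc n"] by (simp add: Z.markov' coll_Suc)
  qed
  have HZ: "(\<integral>\<^sup>+\<omega>. H (Z N \<omega>) \<partial>(?L \<Otimes>\<^sub>M ?L)) = (\<Sum>n. coll (n + N) (x, x))" for N
    unfolding H_def using Zm by (subst nn_integral_suminf) (auto simp: Z_coll)
  define E where "E N = {\<omega> \<in> space (?L \<Otimes>\<^sub>M ?L). \<exists>n\<ge>N. Z n \<omega> \<in> {y. fst y = snd y}}" for N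
  have Es: "E N \<in> sets (?L \<Otimes>\<^sub>M ?L)" for N
  proof -
    have "E N = (\<Union>n\<in>{N..}. Z n -` {y. fst y = snd y} \<inter> space (?L \<Otimes>\<^sub>M ?L))"
      by (auto simp: E_def)
    then show ?thesis
      by (simp only:) (intro sets.countable_UN'' measurable_sets[OF Zm], auto)
  qed
  have EN: "c * emeasure (?L \<Otimes>\<^sub>M ?L) (E N) \<le> (\<Sum>n. coll (n + N) (x, x))" for N
    unfolding E_def HZ[symmetric]
  proof (rule Z.maximal_inequality)
    show "(\<integral>\<^sup>+s. H s \<partial>pair_step z) \<le> H z" for z
      unfolding super unfolding H_def using suminf_offset[of "\<lambda>n. coll n z" 1] by simp
    show "c \<le> H z" if "z \<in> {y. fst y = snd y}" for z
      using that lower[of "fst z"] by (cases z) (auto simp: H_def)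
  qed
  obtain r where r: "\<And>n. coll n (x, x) = ennreal (r n)" "\<And>n. 0 \<le> r n" "summable r"
  proof
    have top: "coll n (x, x) < \<top>" for n
      using fin ennreal_suminf_lessD by blast
    show "coll n (x, x) = ennreal (enn2real (coll n (x, x)))" for n
      using top[of n] by simp
    show "summable (\<lambda>n. enn2real (coll n (x, x)))"
      using fin top by (intro summable_suminf_not_top) auto
  qed auto
  have "(\<lambda>N. \<Sum>n. coll (n + N) (x, x)) = (\<lambda>N. ennreal (\<Sum>n. r (n + N)))"
    using r by (auto simp: suminf_ennreal2 summable_iff_shift)
  moreover have "(\<lambda>N. \<Sum>n. r (n + N)) \<longlonglongrightarrow> 0"
    using suminf_exist_split2[OF r(3)] by simp
  ultimately have tail0: "(\<lambda>N. \<Sum>n. coll (n + N) (x, x)) \<longlonglongrightarrow> 0"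
    using tendsto_ennrealI by fastforce
  have "c * emeasure (?L \<Otimes>\<^sub>M ?L) (\<Inter>N. E N) \<le> (\<Sum>n. coll (n + N) (x, x))" for N
    using EN[of N] Es by (meson INT_lower UNIV_I emeasure_mono mult_left_mono order_trans zero_le)
  then have "c * emeasure (?L \<Otimes>\<^sub>M ?L) (\<Inter>N. E N) \<le> 0"
    by (intro LIMSEQ_le_const[OF tail0]) auto
  then have "emeasure (?L \<Otimes>\<^sub>M ?L) (\<Inter>N. E N) = 0"
    using c by auto
  then have "AE \<omega> in ?L \<Otimes>\<^sub>M ?L. \<omega> \<notin> (\<Inter>N. E N)"
    using Es by (intro AE_not_in) (auto simp: null_sets_def)
  then show ?thesis
  proof (rule AE_mp, intro AE_I2 impI)
    fix \<omega> assume "\<omega> \<in> space (?L \<Otimes>\<^sub>M ?L)" "\<omega> \<notin> (\<Inter>N. E N)"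
    then obtain N where "\<forall>n\<ge>N. fst \<omega> n \<noteq> snd \<omega> n"
      by (auto simp: E_def Z_def)
    then have "{n. fst \<omega> n = snd \<omega> n} \<subseteq> {..N}"
      by (metis (mono_tags, lifting) atMost_iff mem_Collect_eq nat_le_linear subsetI)
    then show "case \<omega> of (X1, X2) \<Rightarrow> finite {n. X1 n = X2 n}"
      by (auto simp: case_prod_beta intro: finite_subset)
  qed
qed

end

section \<open>Comb graphs\<close>

locale comb_profile =
  fixes K :: "int \<Rightarrow> real"
  assumes K_nonneg: "0 \<le> K x"
begin

lemma nb_base: "neighbours (comb K) (x, 0) = {(x - 1, 0), (x + 1, 0)} \<union> (if 1 \<le> K x then {(x, 1)} else {})"
  by (auto simp: neighbours_def edges_comb verts_comb K_nonneg)

lemma nb_tooth: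
  assumes "real (Suc l) \<le> K x"
  shows "neighbours (comb K) (x, Suc l) =
    {(x, l)} \<union> (if real (Suc (Suc l)) \<le> K x then {(x, Suc (Suc l))} else {})"
  using assms by (auto simp: neighbours_def edges_comb verts_comb K_nonneg)

text \<open>Every edge changes the sum of position and height by one, so its parity is a proper
  2-colouring.\<close>

sublocale bipartite_walk "comb K" "(0, 0)" "\<lambda>v. even (fst v + int (snd v))"
proof
  fix v assume v: "v \<in> verts (comb K)"
  show "finite (neighbours (comb K) v)"
    using connected_locally_finite_graph.locally_finite[OF connected_locally_finite_graph_comb v] K_nonneg
    by simp
  show "neighbours (comb K) v \<noteq> {}"
    using neighbours_comb_nonempty[OF K_nonneg v] .
next
  show "(0, 0) \<in> verts (comb K)" by (simp add: verts_comb K_nonneg)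
next
  fix v w
  show "v \<in> verts (comb K) \<Longrightarrow> w \<in> neighbours (comb K) v \<Longrightarrow>
      even (fst w + int (snd w)) \<longleftrightarrow> \<not> even (fst v + int (snd v))"
    (is "_ \<Longrightarrow> _ \<Longrightarrow> even ?b \<longleftrightarrow> \<not> even ?a")
  proof -
    assume "v \<in> verts (comb K)" "w \<in> neighbours (comb K) v"
    then have "\<bar>?b - ?a\<bar> = 1"
      by (cases v, cases w) (auto simp: neighbours_def edges_comb abs_minus_commute)
    then show ?thesis by presburger
  qed
qed

lemma tooth_nonempty_base: "(x, 0) \<in> verts (comb K)"
  by (simp add: verts_comb K_nonneg)

lemma deg_le_3: "v \<in> verts (comb K) \<Longrightarrow> deg v \<le> 3"
proof -
  assume v: "v \<in> verts (comb K)"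
  obtain x l where [simp]: "v = (x, l)" by (cases v)
  show ?thesis
  proof (cases l)
    case 0
    then show ?thesis by (simp add: deg_def nb_base card_insert_if)
  next
    case (Suc k)
    then show ?thesis using v by (simp add: deg_def nb_tooth verts_comb card_insert_if)
  qed
qed

lemma supp_range: "(x, l) \<in> supp n \<Longrightarrow> \<bar>x\<bar> \<le> int n"
proof (induction n arbitrary: x l)
  case (Suc n)
  then obtain v where v: "v \<in> supp n" "(x, l) \<in> neighbours (comb K) v"
    using supp(2)[of n] set_srw_step unfolding supp_def by (auto simp: subset_iff)
  obtain y k where "v = (y, k)" by (cases v)
  with v Suc.IH[of y k] show ?case by (auto simp: neighbours_def edges_comb)
qed (simp add: supp_def)

text \<open>
  Off the comb the value 1 makes the lower bound \<open>coll_sum_ge\<close> hold at every vertex.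
\<close>

definition weight :: "int \<times> nat \<Rightarrow> ennreal" where
  "weight v = (if v \<in> verts (comb K) then ennreal (1 / (real (snd v) + 1)) else 1)"

text \<open>Markov's inequality: the expected value of \<open>\<phi>\<close> at time
  \<open>n\<close> is at most k^2 / 2, while \<open>\<phi>\<close> is at least k^2 away from the
  heights 1 to 2 k of the starting tooth.\<close>

lemma stay_near:
  assumes v: "(x, k) \<in> verts (comb K)" and k: "1 \<le> k" and n: "2 * n \<le> k\<^sup>2"
  shows "1 / 2 \<le> (\<Sum>j\<in>{1..2 * k}. pmf (walk_pmf (comb K) (x, k) n) (x, j))"
proof -
  \<comment> \<open>The squared displacement, frozen off the tooth, grows by at most 1 per step in expectation.\<close>
  define \<phi> where "\<phi> v = (if fst v = x then (real (snd v) - real k)\<^sup>2 else (real k)\<^sup>2)" for v :: "int \<times> nat"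
  have step: "(\<Sum>w\<in>neighbours (comb K) v. \<phi> w) / deg v + 0 \<le> \<phi> v + 1"
    if "v \<in> verts (comb K)" for v
  proof -
    obtain y l where [simp]: "v = (y, l)" by (cases v)
    show ?thesis
    proof (cases l)
      case 0
      have "\<phi> w \<le> (real k)\<^sup>2" if "w \<in> neighbours (comb K) v" for w
        using that 0 k by (auto simp: nb_base \<phi>_def power2_eq_square algebra_simps split: if_splits)
      then have "(\<Sum>w\<in>neighbours (comb K) v. \<phi> w) \<le> deg v * (real k)\<^sup>2"
        using sum_mono[of "neighbours (comb K) v" \<phi> "\<lambda>_. (real k)\<^sup>2"] by (simp add: deg_def)
      then have "(\<Sum>w\<in>neighbours (comb K) v. \<phi> w) / deg v \<le> (real k)\<^sup>2"
        using deg_ge_1[OF that] by (simp add: field_simps)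
      moreover have "\<phi> v = (real k)\<^sup>2" using 0 by (simp add: \<phi>_def)
      ultimately show ?thesis by simp
    next
      case (Suc m)
      then have K: "real (Suc m) \<le> K y" using that by (simp add: verts_comb)
      show ?thesis
      proof (cases "real (Suc (Suc m)) \<le> K y")
        case True
        then show ?thesis
          using Suc K by (simp add: nb_tooth deg_def \<phi>_def power2_eq_square field_simps)
      next
        case False
        \<comment> \<open>From a tip the walk can only step down. On the starting tooth the tip is
          at height at least \<open>k\<close>, so this raises the squared distance to
          \<open>k\<close> by at most 1.\<close>
        have "real k \<le> real (Suc m)" if "x = y"
        proof -
          have "real k \<le> K y" using v that by (simp add: verts_comb)
          then have "k < Suc (Suc m)" using False by (auto simp: not_le intro: ccontr)
          then show ?thesis by simp
        qed
        then show ?thesis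
          using Suc K False by (auto simp: nb_tooth deg_def \<phi>_def power2_eq_square algebra_simps)
      qed
    qed
  qed
  let ?p = "pmf (walk_pmf (comb K) (x, k) n)" and ?S = "set_pmf (walk_pmf (comb K) (x, k) n)"
  note S = set_walk_pmf[OF v, of n]
  have "expect (x, k) n \<phi> + (\<Sum>i<n. expect (x, k) i (\<lambda>_. 0)) \<le> \<phi> (x, k) + real n * 1"
    by (rule drift[OF v]) (use step set_walk_pmf[OF v] in blast)
  then have E: "expect (x, k) n \<phi> \<le> n"
    by (simp add: expect_def \<phi>_def)
  let ?B = "(\<lambda>j. (x, j)) ` {1..2 * k}"
  have far: "(real k)\<^sup>2 \<le> \<phi> w" if "w \<in> ?S - ?B" for w
  proof -
    have *: "(real k)\<^sup>2 \<le> (real l - real k)\<^sup>2" if "l = 0 \<or> 2 * k < l" for l :: nat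
      using that by (elim disjE) (simp, auto intro!: power_mono)
    show ?thesis using that *[of "snd w"] by (cases w) (auto simp: \<phi>_def image_iff not_less_eq_eq)
  qed
  have "(real k)\<^sup>2 * (\<Sum>w\<in>?S - ?B. ?p w) = (\<Sum>w\<in>?S - ?B. ?p w * (real k)\<^sup>2)"
    by (simp add: sum_distrib_left mult.commute)
  also have "\<dots> \<le> (\<Sum>w\<in>?S - ?B. ?p w * \<phi> w)"
    using far by (intro sum_mono mult_left_mono) auto
  also have "\<dots> \<le> expect (x, k) n \<phi>"
    unfolding expect_def using S by (intro sum_mono2) (auto simp: \<phi>_def)
  also have "\<dots> \<le> (real k)\<^sup>2 / 2" using E n by (simp add: of_nat_power[symmetric] del: of_nat_power)
  finally have "(\<Sum>w\<in>?S - ?B. ?p w) \<le> 1 / 2"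
    using k by (simp add: field_simps)
  moreover have "(\<Sum>w\<in>?S. ?p w) = 1" using S by (intro sum_pmf_eq_1) auto
  moreover have "(\<Sum>w\<in>?S. ?p w) = (\<Sum>w\<in>?S - ?B. ?p w) + (\<Sum>w\<in>?S \<inter> ?B. ?p w)"
    using S by (subst sum.Int_Diff[of _ _ ?B]) auto
  moreover have "(\<Sum>w\<in>?S \<inter> ?B. ?p w) \<le> (\<Sum>w\<in>?B. ?p w)"
    by (intro sum_mono2) auto
  moreover have "(\<Sum>w\<in>?B. ?p w) = (\<Sum>j\<in>{1..2 * k}. ?p (x, j))"
    by (subst sum.reindex) (auto simp: inj_on_def)
  ultimately show ?thesis by simp
qed

lemma coll_ge_sum:
  assumes "finite B"
  shows "(\<Sum>y\<in>B. ennreal ((pmf (walk_pmf (comb K) v n) y)\<^sup>2) * weight y) \<le> coll (comb K) weight n (v, v)"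
proof -
  let ?F = "\<lambda>y. ennreal ((pmf (walk_pmf (comb K) v n) y)\<^sup>2) * weight y"
  have "(\<Sum>y\<in>B. ?F y) = (\<integral>\<^sup>+y. ?F y * indicator B y \<partial>count_space UNIV)"
    using assms by (simp add: nn_integral_count_space_finite nn_integral_count_space_indicator[symmetric])
  also have "\<dots> \<le> (\<integral>\<^sup>+y. ?F y \<partial>count_space UNIV)"
    by (intro nn_integral_mono) (auto simp: indicator_def)
  finally show ?thesis by (simp add: coll_diag)
qed

text \<open>Cauchy-Schwarz over the 2 k heights of \<open>stay_near\<close> bounds the sum of
  squares below by (1 / 2)^2 / (2 k), and the weights at these heights are at least 1 / (3
  k).\<close>

lemma coll_ge:
  assumes v: "(x, k) \<in> verts (comb K)" and k: "1 \<le> k" and n: "2 * n \<le> k\<^sup>2"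
  shows "ennreal (1 / (24 * (real k)\<^sup>2)) \<le> coll (comb K) weight n ((x, k), (x, k))"
proof -
  let ?p = "\<lambda>j. pmf (walk_pmf (comb K) (x, k) n) (x, j)"
  let ?B = "{1..2 * k}"
  have "(1 / 2)\<^sup>2 \<le> (\<Sum>j\<in>?B. 1 * ?p j)\<^sup>2"
    using stay_near[OF v k n] by (intro power_mono) auto
  also have "\<dots> \<le> (\<Sum>j\<in>?B. 1\<^sup>2) * (\<Sum>j\<in>?B. (?p j)\<^sup>2)"
    by (rule Cauchy_Schwarz_ineq_sum)
  finally have CS: "1 / (8 * real k) \<le> (\<Sum>j\<in>?B. (?p j)\<^sup>2)"
    using k by (simp add: field_simps power2_eq_square)
  have "1 / (24 * (real k)\<^sup>2) = 1 / (8 * real k) * (1 / (3 * real k))"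
    by (simp add: power2_eq_square)
  also have "\<dots> \<le> (\<Sum>j\<in>?B. (?p j)\<^sup>2) * (1 / (3 * real k))"
    using CS by (intro mult_right_mono) auto
  also have "\<dots> \<le> (\<Sum>j\<in>?B. (?p j)\<^sup>2 * (1 / (real j + 1)))"
    unfolding sum_distrib_right
  proof (intro sum_mono mult_left_mono)
    fix j assume "j \<in> ?B"
    then have "real (j + 1) \<le> real (3 * k)"
      unfolding of_nat_le_iff using k by auto
    then show "1 / (3 * real k) \<le> 1 / (real j + 1)"
      by (intro divide_left_mono) auto
  qed auto
  finally have "ennreal (1 / (24 * (real k)\<^sup>2)) \<le> ennreal (\<Sum>j\<in>?B. (?p j)\<^sup>2 * (1 / (real j + 1)))"
    by (rule ennreal_leI)
  also have "\<dots> = (\<Sum>j\<in>?B. ennreal ((?p j)\<^sup>2) * ennreal (1 / (real j + 1)))"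
    by (simp add: ennreal_mult'[symmetric] sum_ennreal)
  also have "\<dots> \<le> (\<Sum>j\<in>?B. ennreal ((?p j)\<^sup>2) * weight (x, j))"
    by (intro sum_mono mult_left_mono) (auto simp: weight_def intro!: ennreal_leI simp flip: ennreal_1)
  also have "\<dots> = (\<Sum>y\<in>(\<lambda>j. (x, j)) ` ?B. ennreal ((pmf (walk_pmf (comb K) (x, k) n) y)\<^sup>2) * weight y)"
    by (subst sum.reindex) (auto simp: inj_on_def)
  also have "\<dots> \<le> coll (comb K) weight n ((x, k), (x, k))"
    by (rule coll_ge_sum) auto
  finally show ?thesis .
qed

lemma coll_sum_ge: "ennreal (1 / 48) \<le> (\<Sum>n. coll (comb K) weight n (v, v))"
proof -
  obtain x k where v: "v = (x, k)" by (cases v)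
  have part: "(\<Sum>n<m. coll (comb K) weight n (v, v)) \<le> (\<Sum>n. coll (comb K) weight n (v, v))" for m
    by (rule sum_le_suminf) auto
  show ?thesis
  proof (cases "(x, k) \<in> verts (comb K) \<and> 1 \<le> k")
    case True
    define m where "m = Suc (k\<^sup>2 div 2)"
    have m: "k\<^sup>2 \<le> 2 * m" unfolding m_def by presburger
    have "real (k\<^sup>2) \<le> real (2 * m)" using m by (simp only: of_nat_le_iff)
    then have "1 / 48 \<le> real m * (1 / (24 * (real k)\<^sup>2))"
      using True by (simp add: field_simps)
    then have "ennreal (1 / 48) \<le> ennreal (real m * (1 / (24 * (real k)\<^sup>2)))"
      by (rule ennreal_leI)
    also have "\<dots> = (\<Sum>n<m. ennreal (1 / (24 * (real k)\<^sup>2)))"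
      by (simp add: ennreal_mult'[symmetric] ennreal_of_nat_eq_real_of_nat)
    also have "\<dots> \<le> (\<Sum>n<m. coll (comb K) weight n (v, v))"
      unfolding v using True by (intro sum_mono coll_ge) (auto simp: m_def)
    finally show ?thesis using part order_trans by blast
  next
    case False
    \<comment> \<open>On the base and off the comb the collision at time 0 already has weight
      1.\<close>
    then have "weight v = 1"
      by (auto simp: weight_def v Suc_le_eq)
    have "ennreal (1 / 48) \<le> ennreal 1" by (rule ennreal_leI) simp
    also have "\<dots> \<le> coll (comb K) weight 0 (v, v)"
      using coll_ge_sum[of "{v}" v 0] \<open>weight v = 1\<close> by (simp add: pmf_return)
    finally show ?thesis using part[of 1] order_trans by auto
  qed
qed

text \<open>The real form of \<open>coll\<close> at the root, where only finitely many vertices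
  contribute.\<close>

definition wcoll :: "nat \<Rightarrow> real" where
  "wcoll n = (\<Sum>v\<in>supp n. (pmf (walk_pmf (comb K) (0, 0) n) v)\<^sup>2 / (real (snd v) + 1))"

lemma wcoll_nonneg: "0 \<le> wcoll n"
  unfolding wcoll_def by (intro sum_nonneg) auto

lemma coll_root: "coll (comb K) weight n ((0, 0), (0, 0)) = ennreal (wcoll n)"
proof -
  let ?p = "pmf (walk_pmf (comb K) (0, 0) n)"
  have "coll (comb K) weight n ((0, 0), (0, 0)) = (\<integral>\<^sup>+y. ennreal ((?p y)\<^sup>2) * weight y \<partial>count_space UNIV)"
    by (rule coll_diag)
  also have "\<dots> = (\<Sum>y\<in>supp n. ennreal ((?p y)\<^sup>2) * weight y)"
  proof (rule nn_integral_count_space')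
    show "finite (supp n)" by (rule supp)
  qed (auto simp: supp_def pmf_eq_0_set_pmf)
  also have "\<dots> = (\<Sum>y\<in>supp n. ennreal ((?p y)\<^sup>2 / (real (snd y) + 1)))"
  proof (rule sum.cong[OF refl])
    fix y assume "y \<in> supp n"
    then have "y \<in> verts (comb K)" using supp(2) by blast
    then show "ennreal ((?p y)\<^sup>2) * weight y = ennreal ((?p y)\<^sup>2 / (real (snd y) + 1))"
      by (simp add: weight_def ennreal_mult'[symmetric])
  qed
  also have "\<dots> = ennreal (wcoll n)"
    unfolding wcoll_def by (rule sum_ennreal) auto
  finally show ?thesis .
qed

lemma finite_collision_propertyI:
  assumes "summable wcoll"
  shows "finite_collision_property (comb K)"
  unfolding finite_collision_property_def
proof (rule bexI[where x = "(0, 0)"])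
  show "AE (X1, X2) in srw_law (comb K) (0, 0) \<Otimes>\<^sub>M srw_law (comb K) (0, 0). finite {n. X1 n = X2 n}"
  proof (rule finite_collisions[where w = weight and c = "ennreal (1 / 48)"])
    show "(\<Sum>n. coll (comb K) weight n ((0, 0), (0, 0))) < \<top>"
      using assms wcoll_nonneg by (simp add: coll_root suminf_ennreal2)
  qed (auto intro: coll_sum_ge)
qed (rule root)

end

section \<open>Heat kernel bounds on combs with many long teeth\<close>

lemma path_bound:
  fixes a :: "nat \<Rightarrow> real"
  shows "(a 0 - a n)\<^sup>2 \<le> real n * (\<Sum>i<n. (a i - a (Suc i))\<^sup>2)"
proof -
  have "(a 0 - a n)\<^sup>2 = (\<Sum>i<n. 1 * (a i - a (Suc i)))\<^sup>2"
    by (simp add: sum_lessThan_telescope')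
  also have "\<dots> \<le> (\<Sum>i<n. 1\<^sup>2) * (\<Sum>i<n. (a i - a (Suc i))\<^sup>2)"
    by (rule Cauchy_Schwarz_ineq_sum)
  finally show ?thesis by simp
qed

text \<open>The range 8 h^2 covers all positions reachable up to time 4 h^2 + 1 and leaves room for
  shifts by \<open>l\<close> or by up to h^2.\<close>

definition rich :: "(int \<Rightarrow> real) \<Rightarrow> nat \<Rightarrow> nat \<Rightarrow> bool" where
  "rich K h l \<longleftrightarrow> (\<forall>y. \<bar>y\<bar> \<le> 8 * int (h\<^sup>2) \<longrightarrow> (\<exists>x. y \<le> x \<and> x < y + int l \<and> real h \<le> K x))"

context comb_profile
begin

definition dissipation :: "nat \<Rightarrow> real" where
  "dissipation t = ret (2 * t) - ret (2 * t + 2)"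

lemma dissipation_nonneg: "0 \<le> dissipation t"
  using ret_decreasing[of t] by (simp add: dissipation_def)

lemma base_energy:
  assumes "finite X"
  shows "(\<Sum>x\<in>X. (hk2 t (x, 0) - hk2 t (x + 1, 0))\<^sup>2) \<le> 2 * dissipation t"
proof -
  have "(\<Sum>x\<in>X. (hk2 t (x, 0) - hk2 t (x + 1, 0))\<^sup>2)
      \<le> (\<Sum>x\<in>X. \<Sum>w\<in>neighbours (comb K) (x, 0). (hk2 t (x, 0) - hk2 t w)\<^sup>2)"
  proof (rule sum_mono)
    fix x
    show "(hk2 t (x, 0) - hk2 t (x + 1, 0))\<^sup>2
        \<le> (\<Sum>w\<in>neighbours (comb K) (x, 0). (hk2 t (x, 0) - hk2 t w)\<^sup>2)"
      by (rule member_le_sum[where f = "\<lambda>w. (hk2 t (x, 0) - hk2 t w)\<^sup>2"])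
        (auto simp: nb_base)
  qed
  also have "\<dots> = (\<Sum>v\<in>(\<lambda>x. (x, 0)) ` X. \<Sum>w\<in>neighbours (comb K) v. (hk2 t v - hk2 t w)\<^sup>2)"
    by (subst sum.reindex) (auto simp: inj_on_def)
  also have "\<dots> \<le> 2 * dissipation t"
    unfolding dissipation_def using assms tooth_nonempty_base by (intro energy) auto
  finally show ?thesis .
qed

text \<open>Each tooth edge is charged to its upper end, so distinct edges are charged to distinct
  vertices and \<open>energy\<close> applies.\<close>

lemma tooth_energy:
  assumes "finite P" and P: "\<And>x k. (x, k) \<in> P \<Longrightarrow> real (Suc k) \<le> K x"
  shows "(\<Sum>(x, k)\<in>P. (hk2 t (x, k) - hk2 t (x, Suc k))\<^sup>2) \<le> 2 * dissipation t"
proof -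
  let ?up = "\<lambda>(x, k). (x, Suc k) :: int \<times> nat"
  have "(\<Sum>(x, k)\<in>P. (hk2 t (x, k) - hk2 t (x, Suc k))\<^sup>2)
      \<le> (\<Sum>v\<in>P. \<Sum>w\<in>neighbours (comb K) (?up v). (hk2 t (?up v) - hk2 t w)\<^sup>2)"
  proof (rule sum_mono)
    fix v assume "v \<in> P"
    moreover obtain x k where [simp]: "v = (x, k)" by (cases v)
    ultimately have K: "real (Suc k) \<le> K x" using P by auto
    have "(hk2 t (x, Suc k) - hk2 t (x, k))\<^sup>2
        \<le> (\<Sum>w\<in>neighbours (comb K) (x, Suc k). (hk2 t (x, Suc k) - hk2 t w)\<^sup>2)"
      by (rule member_le_sum[where f = "\<lambda>w. (hk2 t (x, Suc k) - hk2 t w)\<^sup>2"])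
        (use K in \<open>auto simp: nb_tooth\<close>)
    then show "(case v of (x, k) \<Rightarrow> (hk2 t (x, k) - hk2 t (x, Suc k))\<^sup>2)
        \<le> (\<Sum>w\<in>neighbours (comb K) (?up v). (hk2 t (?up v) - hk2 t w)\<^sup>2)"
      by (simp add: power2_commute)
  qed
  also have "\<dots> = (\<Sum>v\<in>?up ` P. \<Sum>w\<in>neighbours (comb K) v. (hk2 t v - hk2 t w)\<^sup>2)"
    by (subst sum.reindex) (auto simp: inj_on_def)
  also have "\<dots> \<le> 2 * dissipation t"
    unfolding dissipation_def
  proof (rule energy)
    show "?up ` P \<subseteq> verts (comb K)" using P by (fastforce simp: verts_comb)
  qed (use assms in simp)
  finally show ?thesis .
qed

lemma hk2_eq_0: "v \<notin> supp t \<Longrightarrow> v \<notin> supp (Suc t) \<Longrightarrow> hk2 t v = 0"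
  by (simp add: hk2_def hk_eq_0)

text \<open>Let b be the maximum on the base. If b exceeds 1 / t, the dissipation is at most of
  order b L / h^2, which keeps the kernel above b / 2 on a stretch of base to the right of the
  maximiser. The stretch contains a long tooth per window of length \<open>l\<close>, while mass and
  energy allow only of order L / (h b) such teeth. Comparing the two counts gives a quadratic
  inequality for b; the other two bounds follow.\<close>

lemma sup_bound:
  fixes h l t :: nat and L :: real
  assumes rich: "rich K h l" and l: "1 \<le> l" "l \<le> h" and h: "2 \<le> h"
    and t: "h\<^sup>2 \<le> t" "t \<le> 4 * h\<^sup>2" and L: "1 \<le> L" "ln t \<le> L"
  shows "hk2 t (x, 0) \<le> 32 * L * sqrt (real l / real h ^ 3)" "dissipation t \<le> 64 * L\<^sup>2 * sqrt (real l / real h ^ 3) / (real h)\<^sup>2"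
    "ret (2 * t) \<le> 32 * L * sqrt (real l / real h ^ 3)"
proof -
  define s where "s = sqrt (real l / real h ^ 3)"
  have hpos: "0 < real h" using h by simp
  have s0: "0 < s" using l h by (simp add: s_def)
  have s2: "s\<^sup>2 = real l / real h ^ 3" using l by (simp add: s_def)
  have ls: "l / (real h)\<^sup>2 \<le> s"
    unfolding s_def
  proof (rule real_le_rsqrt)
    have "(l / (real h)\<^sup>2)\<^sup>2 = (l / h) * (real l / real h ^ 3)"
      by (simp add: power2_eq_square power3_eq_cube)
    also have "\<dots> \<le> 1 * (real l / real h ^ 3)"
      using l hpos by (intro mult_right_mono) (auto simp: field_simps)
    finally show "(l / (real h)\<^sup>2)\<^sup>2 \<le> real l / real h ^ 3" by simp
  qed
  have "4 \<le> h\<^sup>2" using power_mono[OF h, of 2] by simp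
  then have t3: "3 \<le> t" using t by simp
  have th: "(real h)\<^sup>2 \<le> real t" using t(1) by (metis of_nat_le_iff of_nat_power)
  have "1 / t \<le> 1 / (real h)\<^sup>2"
    using th hpos by (simp add: frac_le)
  also have "\<dots> \<le> l / (real h)\<^sup>2" using l by (intro divide_right_mono) auto
  also have "\<dots> \<le> s" using ls by simp
  finally have ts: "1 / t \<le> s" .
  have "s \<le> 32 * L * s" using L s0 by simp
  then have ts': "1 / t \<le> 32 * L * s" using ts by linarith
  \<comment> \<open>Used twice: with the maximum on the base to start the argument, and with the
    final bound to obtain the second claim.\<close>
  have Dbound: "dissipation t \<le> 2 * b * L / (real h)\<^sup>2" if "hk2 t (0, 0) \<le> b" "1 / t \<le> b" for b
  proof -
    have b0: "0 < b" using that(2) t3 by (auto intro: less_le_trans[rotated])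
    have "ret (2 * t) \<le> b"
      using that ret_le_hk2_root[of t] t3 by linarith
    then have "dissipation t \<le> 2 * b * ln t / t"
      unfolding dissipation_def using that t3 by (intro decrement_bound) auto
    also have "\<dots> \<le> 2 * b * L / t"
      using b0 L t3 by (intro divide_right_mono mult_left_mono) auto
    also have "\<dots> \<le> 2 * b * L / (real h)\<^sup>2"
      using b0 L th hpos t3 by (intro frac_le) auto
    finally show ?thesis .
  qed
  define X where "X = insert 0 (fst ` (supp t \<union> supp (Suc t)))"
  have X: "finite X" "X \<noteq> {}" using supp by (auto simp: X_def)
  define b where "b = Max ((\<lambda>x. hk2 t (x, 0)) ` X)"
  have "b \<in> (\<lambda>x. hk2 t (x, 0)) ` X" unfolding b_def using X by (intro Max_in) auto
  then obtain x0 where x0: "x0 \<in> X" "hk2 t (x0, 0) = b" by auto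
  have bX: "hk2 t (x, 0) \<le> b" if "x \<in> X" for x
    unfolding b_def using X that by (intro Max_ge) auto
  have b_max: "hk2 t (x, 0) \<le> b" for x
  proof (cases "x \<in> X")
    case False
    then have "(x, 0) \<notin> supp t" "(x, 0) \<notin> supp (Suc t)" by (force simp: X_def)+
    then have "hk2 t (x, 0) = 0" by (rule hk2_eq_0)
    also have "0 \<le> b" using x0 hk2_nonneg[of t "(x0, 0)"] by simp
    finally show ?thesis .
  qed (rule bX)
  have "b \<le> 32 * L * s"
  proof (cases "b \<le> 1 / t")
    case True
    then show ?thesis using ts' by linarith
  next
    case False
    then have bt: "1 / t \<le> b" by simp
    have b0: "0 < b" using bt t3 by (auto intro: less_le_trans[rotated])
    have b2: "b \<le> 2" using hk2_le_2[of t "(x0, 0)"] x0 by simp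
    have D: "dissipation t \<le> 2 * b * L / (real h)\<^sup>2" by (rule Dbound[OF b_max bt])
    have x0t: "\<bar>x0\<bar> \<le> 4 * int (h\<^sup>2) + 1"
    proof -
      have "\<bar>x0\<bar> \<le> int t + 1"
        using x0(1) supp_range by (fastforce simp: X_def)
      also have "int t \<le> 4 * int (h\<^sup>2)" using t(2) by linarith
      finally show ?thesis by simp
    qed
    \<comment> \<open>Chosen so that \<open>r\<close> times twice the bound on the dissipation
      equals (b / 2)^2 in the path estimate below.\<close>
    define r where "r = b * (real h)\<^sup>2 / (16 * L)"
    have r0: "0 \<le> r" using b0 L by (simp add: r_def)
    define R where "R = nat \<lfloor>r\<rfloor>"
    have R: "real R \<le> r" "r < real R + 1" using r0 by (auto simp: R_def)
    have "r \<le> 2 * (real h)\<^sup>2 / (16 * 1)"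
      unfolding r_def using b0 b2 L by (intro frac_le mult_mono) auto
    then have "real R \<le> (real h)\<^sup>2" using R(1) zero_le_power2[of "real h"] by linarith
    then have "R \<le> h\<^sup>2" by simp
    then have Rh: "int R \<le> int (h\<^sup>2)" by linarith
    have near: "b / 2 \<le> hk2 t (x0 + int i, 0)" if "i \<le> R" for i
    proof -
      let ?a = "\<lambda>j. hk2 t (x0 + int j, 0)"
      have "(\<Sum>j<i. (?a j - ?a (Suc j))\<^sup>2)
          = (\<Sum>x\<in>(\<lambda>j. x0 + int j) ` {..<i}. (hk2 t (x, 0) - hk2 t (x + 1, 0))\<^sup>2)"
        by (subst sum.reindex) (auto simp: inj_on_def add_ac)
      also have "\<dots> \<le> 2 * dissipation t" by (rule base_energy) simp
      finally have "real i * (\<Sum>j<i. (?a j - ?a (Suc j))\<^sup>2) \<le> real R * (2 * dissipation t)"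
        using that dissipation_nonneg by (intro mult_mono sum_nonneg) auto
      with path_bound[of ?a i] have "(b - ?a i)\<^sup>2 \<le> real R * (2 * dissipation t)"
        using x0 by simp
      also have "\<dots> \<le> r * (2 * (2 * b * L / (real h)\<^sup>2))"
        using R D r0 dissipation_nonneg by (intro mult_mono mult_left_mono) auto
      also have "\<dots> = (b / 2)\<^sup>2"
        using L hpos by (simp add: r_def power2_eq_square)
      finally have "\<bar>b - ?a i\<bar> \<le> b / 2"
        using b0 by (simp add: abs_le_square_iff[symmetric])
      then show ?thesis by linarith
    qed
    \<comment> \<open>The number of disjoint windows of length \<open>l\<close> that fit into the
      stretch; one long tooth is picked from each.\<close>
    define J where "J = R div l"
    have Jl: "J * l \<le> R" "R < (J + 1) * l"
      using l dividend_less_div_times[of l R] by (auto simp: J_def)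
    have "\<exists>x. x0 + int (j * l) \<le> x \<and> x < x0 + int (j * l) + int l \<and> real h \<le> K x" if "j < J" for j
    proof -
      have "j * l \<le> R" using that Jl(1) by (meson less_imp_le mult_le_mono1 order_trans)
      then have "int (j * l) \<le> int (h\<^sup>2)" using Rh by linarith
      then have "\<bar>x0 + int (j * l)\<bar> \<le> 8 * int (h\<^sup>2)"
        using x0t \<open>4 \<le> h\<^sup>2\<close> by linarith
      then show ?thesis using rich unfolding rich_def by blast
    qed
    then obtain sj where sj: "\<And>j. j < J \<Longrightarrow> x0 + int (j * l) \<le> sj j"
        "\<And>j. j < J \<Longrightarrow> sj j < x0 + int (j * l) + int l" "\<And>j. j < J \<Longrightarrow> real h \<le> K (sj j)"
      by metis
    have sj_less: "sj i < sj j" if "i < j" "j < J" for i j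
    proof -
      have "int (i * l) + int l \<le> int (j * l)"
        using mult_le_mono1[of "Suc i" j l] that by (simp add: add.commute flip: of_nat_add of_nat_mult)
      then show ?thesis using sj(2)[of i] sj(1)[of j] that by linarith
    qed
    have inj: "inj_on sj {..<J}"
      by (rule inj_onI) (metis lessThan_iff less_irrefl nat_neq_iff sj_less)
    define S where "S = sj ` {..<J}"
    have S: "finite S" "card S = J" using inj by (auto simp: S_def card_image)
    have S_near: "b / 2 \<le> hk2 t (x, 0)" and S_K: "real h \<le> K x" if x: "x \<in> S" for x
    proof -
      obtain j where j: "j < J" "x = sj j" using x by (auto simp: S_def)
      have "int (j * l) + int l \<le> int (J * l)"
        using mult_le_mono1[of "Suc j" J l] j by (simp add: add.commute flip: of_nat_add of_nat_mult)
      then have "x0 \<le> x" "x - x0 \<le> int R"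
        using sj(1,2)[OF j(1)] j(2) Jl(1) by linarith+
      then show "b / 2 \<le> hk2 t (x, 0)" using near[of "nat (x - x0)"] by simp
      show "real h \<le> K x" using sj(3) j by simp
    qed
    define E where "E x = (\<Sum>k<h. (hk2 t (x, k) - hk2 t (x, Suc k))\<^sup>2)" for x
    \<comment> \<open>A long tooth either carries mass of order \<open>h b\<close> or dissipates energy of order \<open>b\<^sup>2 / h\<close>;
      this is the linearised form, by AM-GM.\<close>
    have per_tooth: "real h * (b / 4) \<le> (\<Sum>k=1..h. hk2 t (x, k)) + (real h)\<^sup>2 * E x / b"
      if x: "x \<in> S" for x
    proof -
      have "b / 4 \<le> hk2 t (x, k) + real h * E x / b" if k: "k \<in> {1..h}" for k
      proof -
        let ?d = "hk2 t (x, 0) - hk2 t (x, k)"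
        have "?d\<^sup>2 \<le> real k * (\<Sum>i<k. (hk2 t (x, i) - hk2 t (x, Suc i))\<^sup>2)"
          by (rule path_bound)
        also have "\<dots> \<le> real h * E x"
          unfolding E_def using k by (intro mult_mono sum_mono2 sum_nonneg) auto
        finally have "?d\<^sup>2 \<le> real h * E x" .
        moreover have "b * ?d \<le> ?d\<^sup>2 + b\<^sup>2 / 4"
          using zero_le_power2[of "?d - b / 2"] by (simp add: power2_eq_square algebra_simps)
        ultimately have "b * ?d \<le> real h * E x + b * (b / 4)"
          by (simp add: power2_eq_square)
        then have "?d \<le> real h * E x / b + b / 4"
          using b0 by (simp add: field_simps)
        then show ?thesis using S_near[OF x] by linarith
      qed
      then have "(\<Sum>k=1..h. b / 4) \<le> (\<Sum>k=1..h. hk2 t (x, k) + real h * E x / b)"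
        by (rule sum_mono)
      then show ?thesis by (simp add: sum.distrib power2_eq_square)
    qed
    \<comment> \<open>Summation over the chosen teeth: their total mass is at most 2, and their
      edges share a single energy bound.\<close>
    have "real J * (real h * (b / 4)) = (\<Sum>x\<in>S. real h * (b / 4))" using S by simp
    also have "\<dots> \<le> (\<Sum>x\<in>S. (\<Sum>k=1..h. hk2 t (x, k)) + (real h)\<^sup>2 * E x / b)"
      by (rule sum_mono) (rule per_tooth)
    also have "\<dots> = (\<Sum>v\<in>S \<times> {1..h}. hk2 t v) + (real h)\<^sup>2 * (\<Sum>x\<in>S. E x) / b"
      by (simp add: sum.distrib sum.cartesian_product sum_distrib_left sum_divide_distrib)
    also have "\<dots> \<le> 2 + (real h)\<^sup>2 * (2 * dissipation t) / b"
    proof (intro add_mono sum_hk2_le divide_right_mono mult_left_mono)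
      have "(\<Sum>x\<in>S. E x) = (\<Sum>(x, k)\<in>S \<times> {..<h}. (hk2 t (x, k) - hk2 t (x, Suc k))\<^sup>2)"
        unfolding E_def by (rule sum.cartesian_product)
      also have "\<dots> \<le> 2 * dissipation t"
        using S S_K by (intro tooth_energy) force+
      finally show "(\<Sum>x\<in>S. E x) \<le> 2 * dissipation t" .
    qed (use S b0 in auto)
    also have "\<dots> \<le> 2 + (real h)\<^sup>2 * (2 * (2 * b * L / (real h)\<^sup>2)) / b"
      using D b0 by (intro add_mono divide_right_mono mult_left_mono) auto
    also have "\<dots> = 2 + 4 * L" using b0 hpos by simp
    also have "\<dots> \<le> 6 * L" using L by simp
    finally have "real J * (real h * (b / 4)) \<le> 6 * L" .
    then have "real J * b \<le> 24 * L / h" using hpos by (simp add: field_simps)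
    have "R + 1 \<le> (J + 1) * l" using Jl(2) by simp
    then have "real R + 1 \<le> (real J + 1) * l"
      by (metis of_nat_1 of_nat_add of_nat_le_iff of_nat_mult)
    then have "r \<le> (real J + 1) * l" using R(2) by linarith
    then have "r * b \<le> (real J + 1) * l * b" using b0 by (intro mult_right_mono) auto
    also have "\<dots> = l * (real J * b + b)" by (simp add: algebra_simps)
    also have "\<dots> \<le> l * (24 * L / h + b)"
      using \<open>real J * b \<le> 24 * L / h\<close> by (intro mult_left_mono) auto
    finally have "b\<^sup>2 * (real h)\<^sup>2 / (16 * L) \<le> l * (24 * L / h + b)"
      by (simp add: r_def power2_eq_square mult_ac)
    then have "b\<^sup>2 \<le> l * (24 * L / h + b) * (16 * L) / (real h)\<^sup>2"
      using L hpos by (simp add: field_simps)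
    also have "\<dots> = 384 * L\<^sup>2 * (real l / real h ^ 3) + 16 * L * b * (l / (real h)\<^sup>2)"
      using hpos by (simp add: field_simps power2_eq_square power3_eq_cube)
    also have "\<dots> \<le> 384 * L\<^sup>2 * s\<^sup>2 + 16 * L * b * s"
      using ls L b0 by (intro add_mono mult_left_mono) (auto simp: s2)
    finally have quad: "b\<^sup>2 \<le> 384 * L\<^sup>2 * s\<^sup>2 + 16 * L * b * s" .
    show ?thesis
    proof (rule ccontr)
      assume "\<not> b \<le> 32 * L * s"
      then have big: "32 * (L * s) < b" by simp
      \<comment> \<open>In terms of y, \<open>quad\<close> reads b^2 \<le> 384 y^2 + 16 y b;
        together with b > 32 y this forces b \<le> 24 y.\<close>
      define y where "y = L * s"
      have y0: "0 < y" using L s0 by (simp add: y_def)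
      have "b\<^sup>2 \<le> 384 * y\<^sup>2 + 16 * y * b"
        using quad by (simp add: y_def power_mult_distrib mult_ac)
      moreover have "32 * y * b \<le> b\<^sup>2"
        using big b0 by (simp add: y_def power2_eq_square)
      ultimately have "16 * y * b \<le> 384 * y\<^sup>2" by linarith
      then have "b \<le> 24 * y" using y0 by (simp add: power2_eq_square)
      then show False using big y0 by (simp add: y_def)
    qed
  qed
  then have all: "hk2 t (x, 0) \<le> 32 * L * s" for x using b_max[of x] by linarith
  show "hk2 t (x, 0) \<le> 32 * L * sqrt (real l / real h ^ 3)" using all by (simp add: s_def)
  show "dissipation t \<le> 64 * L\<^sup>2 * sqrt (real l / real h ^ 3) / (real h)\<^sup>2"
    using Dbound[OF all ts'] by (simp add: s_def power2_eq_square mult_ac)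
  show "ret (2 * t) \<le> 32 * L * sqrt (real l / real h ^ 3)"
    using ret_le_hk2_root[of t] t3 all[of 0] by (simp add: s_def)
qed

section \<open>Time spent on the base\<close>

definition at_base :: "int \<times> nat \<Rightarrow> real" where
  "at_base v = (if snd v = 0 then 1 else 0)"


text \<open>The mean one-step change of a nonnegative function \<open>\<phi>\<close> is at most
  \<open>a\<close> off the base and at most \<open>a - 2 / 3\<close> on it. Hence the expected
  number of base visits in \<open>n\<close> steps is at most 3 / 2 times
  \<open>\<phi> (0, 0) + n * a\<close>, which is of order h l.\<close>

lemma base_time:
  fixes h l :: nat
  assumes rich: "rich K h l" and l: "1 \<le> l" "l \<le> h" and h: "2 \<le> h"
  shows "(\<Sum>i<4 * h\<^sup>2 + 2. expect (0, 0) i at_base) \<le> 50 * real h * real l"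
proof -
  \<comment> \<open>The largest distance reachable at times below 4 h^2 + 2.\<close>
  define T where "T = 4 * int (h\<^sup>2) + 1"
  have hpos: "0 < real h" using h by simp
  have h2: "int h * 2 \<le> int (h\<^sup>2)" "4 \<le> int (h\<^sup>2)"
    using h mult_mono[of 2 "int h" 2 "int h"] mult_left_mono[of 2 "int h" "int h"]
    by (simp_all add: power2_eq_square)
  \<comment> \<open>Sites beyond \<open>T\<close> are added to the long teeth so that the distances
    \<open>up\<close> and \<open>down\<close> to \<open>S\<close> exist everywhere.\<close>
  define S where "S = {x. real h \<le> K x \<or> T < \<bar>x\<bar>}"
  define up where "up x = (LEAST d. x + int d \<in> S)" for x
  define down where "down x = (LEAST d. x - int d \<in> S)" for x
  have ex_up: "\<exists>d. x + int d \<in> S" and ex_down: "\<exists>d. x - int d \<in> S" for x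
  proof -
    have "T < \<bar>x + int (nat (\<bar>x\<bar> + \<bar>T\<bar> + 1))\<bar>" "T < \<bar>x - int (nat (\<bar>x\<bar> + \<bar>T\<bar> + 1))\<bar>"
      by linarith+
    then show "\<exists>d. x + int d \<in> S" "\<exists>d. x - int d \<in> S"
      unfolding S_def by blast+
  qed
  have up: "x + int (up x) \<in> S" and down: "x - int (down x) \<in> S" for x
    unfolding up_def down_def using ex_up ex_down by (auto intro: LeastI_ex)
  have up_le: "up x \<le> d" if "x + int d \<in> S" for x d
    unfolding up_def using that by (rule Least_le)
  have down_le: "down x \<le> d" if "x - int d \<in> S" for x d
    unfolding down_def using that by (rule Least_le)
  have up_l: "up x \<le> l" if "\<bar>x\<bar> \<le> T + 1" for x
  proof -
    have "\<bar>x\<bar> \<le> 8 * int (h\<^sup>2)" using that h2 by (simp add: T_def)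
    then obtain y where "x \<le> y" "y < x + int l" "real h \<le> K y"
      using rich unfolding rich_def by blast
    then have "up x \<le> nat (y - x)" by (intro up_le) (simp add: S_def)
    also have "\<dots> \<le> l" using \<open>y < x + int l\<close> by simp
    finally show ?thesis .
  qed
  have down_l: "down x \<le> l" if "\<bar>x\<bar> \<le> T + 1" for x
  proof -
    have "\<bar>x - int l\<bar> \<le> 8 * int (h\<^sup>2)" using that h2 l by (simp add: T_def)
    then obtain y where "x - int l \<le> y" "y < x - int l + int l" "real h \<le> K y"
      using rich unfolding rich_def by blast
    then have "down x \<le> nat (x - y)" by (intro down_le) (simp add: S_def)
    also have "\<dots> \<le> l" using \<open>x - int l \<le> y\<close> by simp
    finally show ?thesis .
  qed
  \<comment> \<open>The mean exit time of simple random walk on the integers from the gap of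
    \<open>S\<close> around \<open>x\<close>: it vanishes on \<open>S\<close> and has second
    difference -2 inside a gap.\<close>
  define W where "W x = real (down x) * real (up x)" for x
  have W_nonneg: "0 \<le> W x" for x by (simp add: W_def)
  have W_S: "W x = 0" "W (x + 1) \<le> l" "W (x - 1) \<le> l" if "x \<in> S" "\<bar>x\<bar> \<le> T" for x
  proof -
    show "W x = 0" using down_le[of x 0] that by (simp add: W_def)
    have "down (x + 1) \<le> 1" "up (x - 1) \<le> 1"
      using that by (auto intro!: down_le up_le)
    moreover have "up (x + 1) \<le> l" "down (x - 1) \<le> l"
      using that by (auto intro!: down_l up_l)
    ultimately show "W (x + 1) \<le> l" "W (x - 1) \<le> l"
      unfolding W_def using mult_mono[of "real (down (x + 1))" 1 "real (up (x + 1))" l]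
        mult_mono[of "real (down (x - 1))" l "real (up (x - 1))" 1] by auto
  qed
  have W_notS: "W (x + 1) + W (x - 1) \<le> 2 * W x - 2" if "x \<notin> S" for x
  proof -
    have pos: "0 < up x" "0 < down x"
      using that up[of x] down[of x] by (auto intro!: gr0I)
    have "up (x + 1) \<le> up x - 1" "down (x - 1) \<le> down x - 1"
        "up (x - 1) \<le> up x + 1" "down (x + 1) \<le> down x + 1"
      using pos up[of x] down[of x] by (auto intro!: up_le down_le simp: of_nat_diff)
    then have le: "real (up (x + 1)) \<le> real (up x) - 1" "real (down (x - 1)) \<le> real (down x) - 1"
        "real (up (x - 1)) \<le> real (up x) + 1" "real (down (x + 1)) \<le> real (down x) + 1"
      using pos by linarith+
    have "W (x + 1) \<le> (real (down x) + 1) * (real (up x) - 1)"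
        "W (x - 1) \<le> (real (down x) - 1) * (real (up x) + 1)"
      unfolding W_def using le pos by (auto intro!: mult_mono)
    then show ?thesis by (simp add: W_def algebra_simps)
  qed
  \<comment> \<open>Large enough that the drop of \<open>A * q\<close> on the first step into a long
    tooth, at least 2 (l + 1), outweighs the values of \<open>W\<close> at the two base neighbours,
    at most 2 l in sum, with 2 to spare.\<close>
  define A where "A = 4 * real h * (real l + 1)"
  \<comment> \<open>A parabola from 1 at height 0 to its minimum 1 / 2 at height \<open>h\<close>,
    continued as a constant. The vanishing slope at \<open>h\<close> keeps the second difference at
    most 1 / h^2 across the joint.\<close>
  define q where "q k = (if k \<le> h then 1 - real k / h + (real k)\<^sup>2 / (2 * (real h)\<^sup>2) else 1 / 2)" for k
  \<comment> \<open>The Lyapunov function: \<^term>\<open>W\<close> drifts down between consecutive long teeth; at a long tooth, \<^term>\<open>q\<close>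
    decreases along the tooth and so compensates the convex kink of \<^term>\<open>W\<close>, gaining at most
    \<open>A / (2 h\<^sup>2)\<close> per step inside.\<close>
  define \<phi> where "\<phi> v = W (fst v) + A * (if real h \<le> K (fst v) then q (snd v) else 1)" for v :: "int \<times> nat"
  have A0: "0 \<le> A" by (simp add: A_def)
  have q_half: "1 / 2 \<le> q k" for k
  proof (cases "k \<le> h")
    case True
    have "0 \<le> (1 - real k / h)\<^sup>2" by simp
    then show ?thesis
      using True by (simp add: q_def power2_diff power_divide)
  qed (simp add: q_def)
  have \<phi>_nonneg: "0 \<le> \<phi> v" for v
    using W_nonneg[of "fst v"] q_half[of "snd v"] A0 by (auto simp: \<phi>_def)
  have q0: "q 0 = 1" by (simp add: q_def)
  have q1: "A * (q 1 - 1) \<le> - 2 * (real l + 1)"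
  proof -
    have "q 1 - 1 = - 1 / h + 1 / (2 * (real h)\<^sup>2)" using h by (simp add: q_def)
    also have "\<dots> \<le> - 1 / (2 * real h)"
      using h hpos by (simp add: field_simps power2_eq_square)
    finally have "A * (q 1 - 1) \<le> A * (- 1 / (2 * real h))"
      using A0 by (rule mult_left_mono)
    moreover have "A * (- 1 / (2 * real h)) = - 2 * (real l + 1)"
      using hpos by (simp add: A_def field_simps)
    ultimately show ?thesis by simp
  qed
  define a where "a = A / (2 * (real h)\<^sup>2)"
  have a0: "0 \<le> a" using A0 by (simp add: a_def)
  have q_conv: "q (Suc (Suc m)) + q m \<le> 2 * q (Suc m) + 1 / (real h)\<^sup>2" if "Suc m < h" for m
    using that hpos by (simp add: q_def field_simps power2_eq_square)
  have q_top: "q m = q (Suc m) + 1 / (2 * (real h)\<^sup>2)" if "Suc m = h" for m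
  proof -
    have m: "real m = real h - 1" "m \<le> h" using that by auto
    have "q (Suc m) = 1 / 2" using that hpos by (simp add: q_def power2_eq_square)
    moreover have "q m = 1 / 2 + 1 / (2 * (real h)\<^sup>2)"
    proof -
      define y where "y = real m / h"
      have "q m = 1 - y + y\<^sup>2 / 2"
        using m(2) by (simp add: q_def y_def power_divide)
      also have "\<dots> = 1 / 2 + (1 - y)\<^sup>2 / 2"
        by (simp add: power2_diff field_simps)
      also have "1 - y = 1 / h" using m hpos by (simp add: y_def field_simps)
      finally show ?thesis by (simp add: power_divide)
    qed
    ultimately show ?thesis by simp
  qed
  have q_flat: "q k = 1 / 2" if "h \<le> k" for k
    using that hpos by (cases "k = h") (auto simp: q_def power2_eq_square)
  have step: "(\<Sum>w\<in>neighbours (comb K) v. \<phi> w) / deg v + 2 / 3 * at_base v \<le> \<phi> v + a"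
    if v: "v \<in> verts (comb K)" and T: "\<bar>fst v\<bar> \<le> T" for v
  proof -
    obtain x k where [simp]: "v = (x, k)" by (cases v)
    show ?thesis
    proof (cases k)
      case 0
      show ?thesis
      proof (cases "real h \<le> K x")
        case True
        then have K1: "1 \<le> K x" using h by simp
        have S: "x \<in> S" using True by (simp add: S_def)
        have "(\<Sum>w\<in>neighbours (comb K) v. \<phi> w) = W (x - 1) + W (x + 1) + 3 * A + A * (q 1 - 1)"
          using K1 True 0 W_S(1)[OF S] T by (simp add: nb_base \<phi>_def q0 algebra_simps)
        also have "\<dots> \<le> 3 * A - 2"
          using W_S(2,3)[OF S] T q1 by simp
        finally have "(\<Sum>w\<in>neighbours (comb K) v. \<phi> w) / 3 \<le> A - 2 / 3" by simp
        moreover have "deg v = 3" using K1 0 by (simp add: deg_def nb_base)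
        moreover have "\<phi> v = A" using True 0 W_S(1)[OF S] T by (simp add: \<phi>_def q0)
        ultimately show ?thesis using 0 a0 by (simp add: at_base_def)
      next
        case False
        then have S: "x \<notin> S" using T by (simp add: S_def)
        have "(\<Sum>w\<in>neighbours (comb K) v. \<phi> w) = W (x + 1) + W (x - 1) - 2 * W x + deg v * \<phi> v"
          using False 0 by (simp add: nb_base \<phi>_def q0 deg_def algebra_simps)
        also have "\<dots> \<le> - 2 + deg v * \<phi> v" using W_notS[OF S] by simp
        finally have "(\<Sum>w\<in>neighbours (comb K) v. \<phi> w) / deg v \<le> (- 2 + deg v * \<phi> v) / deg v"
          using deg_ge_1[OF v] by (intro divide_right_mono) auto
        also have "\<dots> = - 2 / deg v + \<phi> v"
          using deg_ge_1[OF v] by (simp add: field_simps)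
        also have "- 2 / deg v \<le> - 2 / 3"
          using deg_ge_1[OF v] deg_le_3[OF v] by (simp add: field_simps)
        finally show ?thesis using 0 a0 by (simp add: at_base_def)
      qed
    next
      case (Suc m)
      then have Km: "real (Suc m) \<le> K x" using v by (simp add: verts_comb)
      have base0: "at_base v = 0" using Suc by (simp add: at_base_def)
      show ?thesis
      proof (cases "real h \<le> K x")
        \<comment> \<open>On a short tooth \<open>\<phi>\<close> is constant from the base to the
          tip.\<close>
        case False
        then show ?thesis
          using Suc Km a0 base0
          by (cases "real (Suc (Suc m)) \<le> K x") (simp_all add: nb_tooth \<phi>_def deg_def)
      next
        case True
        show ?thesis
        proof (cases "real (Suc (Suc m)) \<le> K x")
          case two: True
          have "q (Suc (Suc m)) + q m \<le> 2 * q (Suc m) + 1 / (real h)\<^sup>2"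
          proof -
            consider "Suc m < h" | "Suc m = h" | "h \<le> m" by linarith
            then show ?thesis
            proof cases
              case 2
              have "1 / (2 * (real h)\<^sup>2) \<le> 1 / (real h)\<^sup>2" using hpos by (simp add: field_simps)
              then show ?thesis
                using q_top[OF 2] q_flat[of "Suc m"] q_flat[of "Suc (Suc m)"] 2 by linarith
            next
              case 3
              then show ?thesis by (simp add: q_flat)
            qed (rule q_conv)
          qed
          then have "A * (q (Suc (Suc m)) + q m) \<le> A * (2 * q (Suc m) + 1 / (real h)\<^sup>2)"
            using A0 by (rule mult_left_mono)
          then show ?thesis
            using Suc Km two True base0 by (simp add: nb_tooth \<phi>_def deg_def a_def algebra_simps)
        next
          \<comment> \<open>The tip of a long tooth has height at least \<open>h\<close>, so the
            only possible step, downwards, raises \<open>q\<close> by at most 1 / (2 h^2).\<close>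
          case one: False
          have "h \<le> Suc m"
            using True one by (metis not_less_eq_eq of_nat_le_iff order_trans)
          then have "q m \<le> q (Suc m) + 1 / (2 * (real h)\<^sup>2)"
            using q_top[of m] by (cases "Suc m = h") (auto simp: q_flat)
          then have "A * q m \<le> A * (q (Suc m) + 1 / (2 * (real h)\<^sup>2))"
            using A0 by (rule mult_left_mono)
          then show ?thesis
            using Suc Km one True base0 by (simp add: nb_tooth \<phi>_def deg_def a_def algebra_simps)
        qed
      qed
    qed
  qed
  define n where "n = 4 * h\<^sup>2 + 2"
  have "expect (0, 0) n \<phi> + (\<Sum>i<n. expect (0, 0) i (\<lambda>v. 2 / 3 * at_base v)) \<le> \<phi> (0, 0) + real n * a"
  proof (rule drift[OF root])
    fix i v assume i: "i < n" and v: "v \<in> set_pmf (walk_pmf (comb K) (0, 0) i)"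
    have "v \<in> supp i" using v by (simp add: supp_def)
    then have "\<bar>fst v\<bar> \<le> int i" using supp_range[of "fst v" "snd v" i] by simp
    also have "int i \<le> T"
    proof -
      have "int i < int (4 * h\<^sup>2 + 2)" using i by (simp only: n_def of_nat_less_iff)
      then show ?thesis by (simp add: T_def)
    qed
    finally have "\<bar>fst v\<bar> \<le> T" .
    moreover have "v \<in> verts (comb K)" using \<open>v \<in> supp i\<close> supp(2) by blast
    ultimately show "(\<Sum>w\<in>neighbours (comb K) v. \<phi> w) / deg v + 2 / 3 * at_base v \<le> \<phi> v + a"
      by (intro step)
  qed
  moreover have "0 \<le> expect (0, 0) n \<phi>"
    unfolding expect_def using \<phi>_nonneg by (intro sum_nonneg) auto
  moreover have "(\<Sum>i<n. expect (0, 0) i (\<lambda>v. 2 / 3 * at_base v)) = 2 / 3 * (\<Sum>i<n. expect (0, 0) i at_base)"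
    by (simp add: expect_def sum_distrib_left mult_ac)
  moreover have "\<phi> (0, 0) \<le> real l * real l + A"
  proof -
    have "W 0 \<le> real l * real l"
      unfolding W_def using up_l[of 0] down_l[of 0] by (intro mult_mono) (auto simp: T_def)
    then show ?thesis by (simp add: \<phi>_def q0)
  qed
  moreover have "real n * a \<le> 3 * A"
  proof -
    have "real n \<le> 3 * (2 * (real h)\<^sup>2)"
    proof -
      have "4 \<le> (real h)\<^sup>2" using power_mono[of 2 "real h" 2] h by simp
      then show ?thesis by (simp add: n_def)
    qed
    then have "real n * a \<le> 3 * (2 * (real h)\<^sup>2) * a" using a0 by (rule mult_right_mono)
    then show ?thesis using hpos by (simp add: a_def)
  qed
  ultimately have "(\<Sum>i<n. expect (0, 0) i at_base) \<le> 6 * A + 2 * (real l * real l)"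
    using zero_le_square[of "real l"] by linarith
  also have "\<dots> \<le> 48 * real h * real l + 2 * (real h * real l)"
  proof (intro add_mono mult_left_mono mult_right_mono)
    have "real h * 1 \<le> real h * real l" using l by (intro mult_left_mono) auto
    then show "6 * A \<le> 48 * real h * real l" by (simp add: A_def algebra_simps)
  qed (use l in auto)
  finally show ?thesis by (simp add: n_def)
qed

end

lemma sum_inverse_le_ln: "(\<Sum>k=1..n. 1 / (real k + 1)) \<le> ln (real n + 1)"
proof (induction n)
  case (Suc n)
  have "ln ((real n + 1) / (real n + 2)) \<le> (real n + 1) / (real n + 2) - 1"
    by (rule ln_le_minus_one) simp
  then have "1 / (real n + 2) \<le> ln (real n + 2) - ln (real n + 1)"
    by (simp add: ln_div field_simps)
  with Suc show ?case by (simp add: add_ac)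
qed simp

text \<open>The blocks match the time ranges from h^2 to 4 h^2 for h = 2^i. All terms before block
  \<open>i0\<close> form a finite sum.\<close>

lemma summable_blocks:
  fixes a c :: "nat \<Rightarrow> real"
  assumes a: "\<And>n. 0 \<le> a n" and c: "summable c"
    and block: "\<And>i. i0 \<le> i \<Longrightarrow> (\<Sum>t=4 ^ i..<4 ^ Suc i. a t) \<le> c i"
  shows "summable a"
proof (rule summableI_nonneg_bounded[OF a])
  fix n
  have c0: "0 \<le> c i" if "i0 \<le> i" for i
    using block[OF that] sum_nonneg[of "{4 ^ i..<4 ^ Suc i}" a] a by (meson order_trans)
  have "(\<Sum>t<4 ^ (i0 + m). a t) \<le> (\<Sum>t<4 ^ i0. a t) + (\<Sum>i<m. c (i + i0))" for m
  proof (induction m)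
    case (Suc m)
    have "(\<Sum>t<4 ^ (i0 + Suc m). a t)
        = (\<Sum>t<4 ^ (i0 + m). a t) + (\<Sum>t=4 ^ (i0 + m)..<4 ^ Suc (i0 + m). a t)"
      unfolding lessThan_atLeast0 by (subst sum.atLeastLessThan_concat) auto
    with Suc block[of "i0 + m"] show ?case by (simp add: add.commute)
  qed simp
  moreover have "(\<Sum>t<n. a t) \<le> (\<Sum>t<4 ^ (i0 + n). a t)"
  proof (rule sum_mono2)
    have "n < 4 ^ n" by (rule less_exp[THEN less_le_trans]) (simp add: power_mono)
    also have "(4 :: nat) ^ n \<le> 4 ^ (i0 + n)" by (rule power_increasing) auto
    finally show "{..<n} \<subseteq> {..<4 ^ (i0 + n)}" by auto
  qed (use a in auto)
  moreover have "(\<Sum>i<n. c (i + i0)) \<le> (\<Sum>i. c (i + i0))"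
    using c c0 by (intro sum_le_suminf) (auto simp: summable_iff_shift)
  ultimately show "(\<Sum>t<n. a t) \<le> (\<Sum>t<4 ^ i0. a t) + (\<Sum>i. c (i + i0))"
    by (meson add_left_mono order_trans)
qed

section \<open>Weighted collisions in one block of times\<close>

context comb_profile
begin

lemma sum_base_hk2:
  assumes "finite B" and B: "\<And>v. v \<in> B \<Longrightarrow> snd v = 0"
  shows "(\<Sum>v\<in>B. hk2 t v) \<le> expect (0, 0) t at_base + expect (0, 0) (Suc t) at_base"
proof -
  have "(\<Sum>v\<in>B. hk n v) \<le> expect (0, 0) n at_base" for n
  proof -
    have "(\<Sum>v\<in>B. hk n v) = (\<Sum>v\<in>B \<inter> supp n. hk n v)"
      using assms by (intro sum.mono_neutral_right) (auto simp: hk_eq_0)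
    also have "\<dots> \<le> (\<Sum>v\<in>B \<inter> supp n. pmf (walk_pmf (comb K) (0, 0) n) v * at_base v)"
      using B hk_le_pmf by (intro sum_mono) (auto simp: at_base_def)
    also have "\<dots> \<le> expect (0, 0) n at_base"
      unfolding expect_def supp_def[symmetric] using supp by (intro sum_mono2) (auto simp: at_base_def)
    finally show ?thesis .
  qed
  from this[of t] this[of "Suc t"] show ?thesis by (simp add: hk2_def sum.distrib)
qed

text \<open>The mass is \<open>deg v * hk t v\<close> and degrees are at most 3, whence the factor
  9.\<close>

lemma wcoll_le_sum: "wcoll t \<le> 9 * (\<Sum>v\<in>supp t. (hk2 t v)\<^sup>2 / (real (snd v) + 1))"
  unfolding wcoll_def sum_distrib_left
proof (rule sum_mono)
  fix v assume v: "v \<in> supp t"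
  have "pmf (walk_pmf (comb K) (0, 0) t) v \<le> 3 * hk2 t v"
    unfolding pmf_eq_hk using v supp deg_le_3[of v] hk_nonneg
    by (intro mult_mono) (auto simp: hk2_def)
  then have "(pmf (walk_pmf (comb K) (0, 0) t) v)\<^sup>2 \<le> (3 * hk2 t v)\<^sup>2"
    by (intro power_mono) auto
  then show "(pmf (walk_pmf (comb K) (0, 0) t) v)\<^sup>2 / (real (snd v) + 1)
      \<le> 9 * ((hk2 t v)\<^sup>2 / (real (snd v) + 1))"
    by (simp add: divide_right_mono power_mult_distrib)
qed

text \<open>Split by height. On the base one factor \<open>hk2\<close> is bounded by
  \<open>\<beta>\<close> and the other is summed. At heights 1 to \<open>h\<close> the kernel is
  compared with its value at the foot of the tooth, and the harmonic sum of the weights costs the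
  factor \<open>L\<close>. Above \<open>h\<close> the weight is below 1 / h and the sum of squares
  is at most \<open>4 * ret (2 * t)\<close>.\<close>

lemma wcoll_le:
  fixes h :: nat and L \<beta> :: real
  assumes h: "2 \<le> h" and L: "1 \<le> L" "ln (real h + 1) \<le> L" and \<beta>: "\<And>x. hk2 t (x, 0) \<le> \<beta>"
    and D: "dissipation t \<le> 2 * \<beta> * L / (real h)\<^sup>2" and ret: "ret (2 * t) \<le> \<beta>"
  shows "wcoll t \<le> 27 * L * \<beta> * (expect (0, 0) t at_base + expect (0, 0) (Suc t) at_base + 4 / h)"
proof -
  define m where "m = expect (0, 0) t at_base + expect (0, 0) (Suc t) at_base"
  have hpos: "0 < real h" using h by simp
  have \<beta>0: "0 \<le> \<beta>" using \<beta>[of 0] hk2_nonneg[of t "(0, 0)"] by simp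
  let ?F = "\<lambda>v. (hk2 t v)\<^sup>2 / (real (snd v) + 1)"
  define B0 where "B0 = {v \<in> supp t. snd v = 0}"
  define B1 where "B1 = {v \<in> supp t. 1 \<le> snd v \<and> snd v \<le> h}"
  define B2 where "B2 = {v \<in> supp t. h < snd v}"
  have fin: "finite B0" "finite B1" "finite B2"
    using supp(1)[of t] by (auto simp: B0_def B1_def B2_def)
  have "sum ?F (B0 \<union> (B1 \<union> B2)) = sum ?F B0 + sum ?F (B1 \<union> B2)"
    by (rule sum.union_disjoint) (use fin in \<open>auto simp: B0_def B1_def B2_def\<close>)
  moreover have "sum ?F (B1 \<union> B2) = sum ?F B1 + sum ?F B2"
    by (rule sum.union_disjoint) (use fin in \<open>auto simp: B1_def B2_def\<close>)
  moreover have "supp t = B0 \<union> (B1 \<union> B2)" by (auto simp: B0_def B1_def B2_def)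
  ultimately have split: "(\<Sum>v\<in>supp t. ?F v) = sum ?F B0 + (sum ?F B1 + sum ?F B2)"
    by (simp only:)
  have base: "(\<Sum>v\<in>B. (hk2 t v)\<^sup>2) \<le> \<beta> * m" if "finite B" "\<And>v. v \<in> B \<Longrightarrow> snd v = 0" for B
  proof -
    have "(\<Sum>v\<in>B. (hk2 t v)\<^sup>2) \<le> (\<Sum>v\<in>B. \<beta> * hk2 t v)"
    proof (rule sum_mono)
      fix v assume "v \<in> B"
      then have "hk2 t v \<le> \<beta>" using that(2)[of v] \<beta>[of "fst v"] by (cases v) auto
      then show "(hk2 t v)\<^sup>2 \<le> \<beta> * hk2 t v"
        unfolding power2_eq_square by (intro mult_right_mono hk2_nonneg)
    qed
    also have "\<dots> \<le> \<beta> * m"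
      unfolding m_def sum_distrib_left[symmetric] using that \<beta>0 by (intro mult_left_mono sum_base_hk2)
    finally show ?thesis .
  qed
  have m0: "0 \<le> m"
    unfolding m_def expect_def at_base_def by (intro add_nonneg_nonneg sum_nonneg) auto
  have F0: "sum ?F B0 \<le> \<beta> * m"
  proof -
    have "sum ?F B0 = (\<Sum>v\<in>B0. (hk2 t v)\<^sup>2)"
      by (rule sum.cong) (auto simp: B0_def)
    also have "\<dots> \<le> \<beta> * m"
      by (rule base) (use fin in \<open>auto simp: B0_def\<close>)
    finally show ?thesis .
  qed
  have F2: "sum ?F B2 \<le> 4 * \<beta> / h"
  proof -
    have "sum ?F B2 \<le> (\<Sum>v\<in>B2. (hk2 t v)\<^sup>2 / h)"
      using hpos by (intro sum_mono divide_left_mono) (auto simp: B2_def)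
    also have "\<dots> \<le> 4 * ret (2 * t) / h"
      unfolding sum_divide_distrib[symmetric]
      using sum_hk2_sq_le[OF fin(3)] hpos by (intro divide_right_mono) auto
    also have "\<dots> \<le> 4 * \<beta> / h" using ret hpos by (intro divide_right_mono) auto
    finally show ?thesis .
  qed
  define X where "X = fst ` B1"
  have X: "finite X" using fin by (simp add: X_def)
  \<comment> \<open>Teeth over \<open>X\<close> may be shorter than \<open>h\<close>; only edges
    inside the comb may enter the energy.\<close>
  define P where "P x = {k \<in> {..<h}. real (Suc k) \<le> K x}" for x
  define E where "E x = (\<Sum>k\<in>P x. (hk2 t (x, k) - hk2 t (x, Suc k))\<^sup>2)" for x
  have E0: "0 \<le> E x" for x unfolding E_def by (intro sum_nonneg) auto
  have sumE: "(\<Sum>x\<in>X. E x) \<le> 2 * dissipation t"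
  proof -
    have "(\<Sum>x\<in>X. E x) = (\<Sum>(x, k)\<in>Sigma X P. (hk2 t (x, k) - hk2 t (x, Suc k))\<^sup>2)"
      unfolding E_def using X by (subst sum.Sigma) (auto simp: P_def)
    also have "\<dots> \<le> 2 * dissipation t"
      using X by (intro tooth_energy finite_SigmaI) (auto simp: P_def)
    finally show ?thesis .
  qed
  define H where "H = (\<Sum>k=1..h. 1 / (real k + 1))"
  have H: "0 \<le> H" "H \<le> L"
    using sum_inverse_le_ln[of h] L by (auto simp: H_def intro!: sum_nonneg)
  \<comment> \<open>The squared difference to the foot is at most k + 1 times the energy of the
    tooth, and the weight 1 / (k + 1) cancels this factor.\<close>
  have "sum ?F B1 \<le> (\<Sum>(x, k)\<in>B1. 2 * (hk2 t (x, 0))\<^sup>2 * (1 / (real k + 1)) + 2 * E x)"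
  proof (rule sum_mono)
    fix v assume "v \<in> B1"
    moreover obtain x k where [simp]: "v = (x, k)" by (cases v)
    ultimately have k: "k \<le> h" "real k \<le> K x"
      using supp(2)[of t] by (auto simp: B1_def verts_comb)
    have "(hk2 t (x, 0) - hk2 t (x, k))\<^sup>2 \<le> real k * (\<Sum>i<k. (hk2 t (x, i) - hk2 t (x, Suc i))\<^sup>2)"
      by (rule path_bound)
    also have "\<dots> \<le> real k * E x"
      unfolding E_def using k
      by (intro mult_left_mono sum_mono2) (auto simp: P_def)
    also have "\<dots> \<le> (real k + 1) * E x" using E0 by (intro mult_right_mono) auto
    finally have d: "(hk2 t (x, 0) - hk2 t (x, k))\<^sup>2 \<le> (real k + 1) * E x" .
    have "(hk2 t (x, k))\<^sup>2 \<le> 2 * (hk2 t (x, 0))\<^sup>2 + 2 * (hk2 t (x, 0) - hk2 t (x, k))\<^sup>2"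
      using zero_le_power2[of "2 * hk2 t (x, 0) - hk2 t (x, k)"]
      by (simp add: power2_eq_square algebra_simps)
    also have "\<dots> \<le> 2 * (hk2 t (x, 0))\<^sup>2 + 2 * ((real k + 1) * E x)"
      using d by simp
    finally have "(hk2 t (x, k))\<^sup>2 / (real k + 1)
        \<le> (2 * (hk2 t (x, 0))\<^sup>2 + 2 * ((real k + 1) * E x)) / (real k + 1)"
      by (intro divide_right_mono) auto
    also have "\<dots> = 2 * (hk2 t (x, 0))\<^sup>2 * (1 / (real k + 1)) + 2 * E x"
      by (simp add: add_divide_distrib)
    finally show "?F v \<le> (case v of (x, k) \<Rightarrow> 2 * (hk2 t (x, 0))\<^sup>2 * (1 / (real k + 1)) + 2 * E x)"
      by simp
  qed
  \<comment> \<open>Passing to the full product adds only nonnegative terms and lets the harmonic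
    sum factor out.\<close>
  also have "\<dots> \<le> (\<Sum>(x, k)\<in>X \<times> {1..h}. 2 * (hk2 t (x, 0))\<^sup>2 * (1 / (real k + 1)) + 2 * E x)"
  proof (rule sum_mono2)
    show "B1 \<subseteq> X \<times> {1..h}" by (force simp: X_def B1_def)
  qed (use X E0 in auto)
  also have "\<dots> = (\<Sum>x\<in>X. 2 * (hk2 t (x, 0))\<^sup>2 * H + real h * (2 * E x))"
    by (simp add: sum.cartesian_product[symmetric] sum.distrib H_def sum_distrib_left)
  also have "\<dots> = 2 * H * (\<Sum>x\<in>X. (hk2 t (x, 0))\<^sup>2) + 2 * real h * (\<Sum>x\<in>X. E x)"
    by (simp add: sum.distrib sum_distrib_left sum_distrib_right mult_ac)
  also have "\<dots> \<le> 2 * L * (\<beta> * m) + 2 * real h * (2 * dissipation t)"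
  proof (intro add_mono mult_mono)
    have "(\<Sum>x\<in>X. (hk2 t (x, 0))\<^sup>2) = (\<Sum>v\<in>(\<lambda>x. (x, 0)) ` X. (hk2 t v)\<^sup>2)"
      by (subst sum.reindex) (auto simp: inj_on_def)
    also have "\<dots> \<le> \<beta> * m" using X by (intro base) auto
    finally show "(\<Sum>x\<in>X. (hk2 t (x, 0))\<^sup>2) \<le> \<beta> * m" .
  qed (use H L sumE E0 in \<open>auto intro!: sum_nonneg\<close>)
  also have "2 * real h * (2 * dissipation t) \<le> 2 * real h * (2 * (2 * \<beta> * L / (real h)\<^sup>2))"
    using D by (intro mult_left_mono) auto
  also have "\<dots> = 8 * \<beta> * L / h"
    using hpos by (simp add: power2_eq_square)
  finally have F1: "sum ?F B1 \<le> 2 * L * (\<beta> * m) + 8 * \<beta> * L / h" by simp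
  have L1: "\<beta> * m \<le> L * (\<beta> * m)" "4 * \<beta> / h \<le> L * (4 * \<beta> / h)"
    using mult_right_mono[OF L(1), of "\<beta> * m"] mult_right_mono[OF L(1), of "4 * \<beta> / h"] \<beta>0 m0
    by simp_all
  have "(\<Sum>v\<in>supp t. ?F v) \<le> 3 * L * (\<beta> * m) + 12 * \<beta> * L / h"
  proof -
    have "8 * \<beta> * L / h = 8 * (L * (\<beta> / h))" "12 * \<beta> * L / h = 12 * (L * (\<beta> / h))"
        "L * (4 * \<beta> / h) = 4 * (L * (\<beta> / h))" "2 * L * (\<beta> * m) = 2 * (L * (\<beta> * m))"
        "3 * L * (\<beta> * m) = 3 * (L * (\<beta> * m))"
      by simp_all
    then show ?thesis using split F0 F1 F2 L1 by linarith
  qed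
  also have "\<dots> = 3 * L * \<beta> * (m + 4 / h)"
    by (simp add: algebra_simps)
  finally show ?thesis
    using wcoll_le_sum[of t] by (simp add: m_def)
qed

text \<open>\<open>sup_bound\<close> supplies 32 L s as the \<open>\<beta>\<close> of
  \<open>wcoll_le\<close>, which gives 27 * 32 = 864. Summed over the block, the two base terms give
  at most 50 h l each and the term 4 / h gives 12 h, together at most 112 h l.\<close>

lemma block_bound:
  fixes h l :: nat and L :: real
  assumes rich: "rich K h l" and l: "1 \<le> l" "l \<le> h" and h: "2 \<le> h"
    and L: "1 \<le> L" "ln (4 * (real h)\<^sup>2) \<le> L"
  shows "(\<Sum>t=h\<^sup>2..<4 * h\<^sup>2. wcoll t) \<le> 96768 * L\<^sup>2 * sqrt (real l / real h ^ 3) * (real h * real l)"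
proof -
  define s where "s = sqrt (real l / real h ^ 3)"
  have hpos: "0 < real h" using h by simp
  have s0: "0 \<le> s" by (simp add: s_def)
  have t_bound: "wcoll t \<le> 864 * L\<^sup>2 * s *
      (expect (0, 0) t at_base + expect (0, 0) (Suc t) at_base + 4 / h)"
    if t: "t \<in> {h\<^sup>2..<4 * h\<^sup>2}" for t
  proof -
    have "0 < h\<^sup>2" using h by simp
    then have "0 < t" using t by auto
    have "real t \<le> real (4 * h\<^sup>2)" using t by (simp only: of_nat_le_iff) simp
    then have "ln t \<le> ln (4 * (real h)\<^sup>2)" using \<open>0 < t\<close> by (intro ln_mono) auto
    then have lnt: "ln t \<le> L" using L by linarith
    have "real h + 1 \<le> 4 * (real h)\<^sup>2"
    proof -
      have "1 \<le> real h" using h by simp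
      then have "real h * 1 \<le> real h * real h" by (intro mult_left_mono) auto
      then show ?thesis using \<open>1 \<le> real h\<close> unfolding power2_eq_square by linarith
    qed
    then have "ln (real h + 1) \<le> ln (4 * (real h)\<^sup>2)" by (intro ln_mono) auto
    then have lnh: "ln (real h + 1) \<le> L" using L by linarith
    have t': "h\<^sup>2 \<le> t" "t \<le> 4 * h\<^sup>2" using t by auto
    note sb = sup_bound[OF rich l h t' L(1) lnt, folded s_def]
    have "wcoll t \<le> 27 * L * (32 * L * s) *
        (expect (0, 0) t at_base + expect (0, 0) (Suc t) at_base + 4 / h)"
      by (rule wcoll_le[OF h L(1) lnh sb(1)])
        (use sb in \<open>auto simp: power2_eq_square mult_ac\<close>)
    then show ?thesis by (simp add: power2_eq_square mult_ac)
  qed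
  have e0: "0 \<le> expect (0, 0) i at_base" for i
    unfolding expect_def by (intro sum_nonneg) (auto simp: at_base_def)
  have bt: "(\<Sum>i<4 * h\<^sup>2 + 2. expect (0, 0) i at_base) \<le> 50 * real h * real l"
    by (rule base_time[OF rich l h])
  have "(\<Sum>t=h\<^sup>2..<4 * h\<^sup>2. expect (0, 0) t at_base) \<le> 50 * real h * real l"
    by (rule order_trans[OF _ bt], rule sum_mono2) (use e0 in auto)
  moreover have "(\<Sum>t=h\<^sup>2..<4 * h\<^sup>2. expect (0, 0) (Suc t) at_base) \<le> 50 * real h * real l"
  proof -
    have "(\<Sum>t=h\<^sup>2..<4 * h\<^sup>2. expect (0, 0) (Suc t) at_base)
        = (\<Sum>t\<in>Suc ` {h\<^sup>2..<4 * h\<^sup>2}. expect (0, 0) t at_base)"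
      by (subst sum.reindex) auto
    also have "\<dots> \<le> (\<Sum>i<4 * h\<^sup>2 + 2. expect (0, 0) i at_base)"
      by (rule sum_mono2) (use e0 in auto)
    finally show ?thesis using bt by linarith
  qed
  moreover have "(\<Sum>t=h\<^sup>2..<4 * h\<^sup>2. 4 / real h) = 12 * real h"
    using hpos by (simp add: power2_eq_square of_nat_diff)
  ultimately have total: "(\<Sum>t=h\<^sup>2..<4 * h\<^sup>2. expect (0, 0) t at_base + expect (0, 0) (Suc t) at_base + 4 / real h)
      \<le> 100 * (real h * real l) + 12 * real h"
    by (simp add: sum.distrib)
  have "(\<Sum>t=h\<^sup>2..<4 * h\<^sup>2. wcoll t) \<le> (\<Sum>t=h\<^sup>2..<4 * h\<^sup>2. 864 * L\<^sup>2 * s *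
      (expect (0, 0) t at_base + expect (0, 0) (Suc t) at_base + 4 / real h))"
    by (rule sum_mono) (rule t_bound)
  also have "\<dots> \<le> 864 * L\<^sup>2 * s * (100 * (real h * real l) + 12 * real h)"
    unfolding sum_distrib_left[symmetric] using total s0 by (intro mult_left_mono) auto
  also have "\<dots> \<le> 864 * L\<^sup>2 * s * (112 * (real h * real l))"
    using l s0 hpos by (intro mult_left_mono) auto
  finally show ?thesis by (simp add: s_def)
qed

end

section \<open>Random profiles\<close>

lemma summable_poly_geometric:
  fixes \<rho> :: real
  assumes "\<rho> < 0"
  shows "summable (\<lambda>i. (2 * real i + 2)\<^sup>2 * 2 powr (\<rho> * real i))"
proof (rule summable_comparison_test_bigo)
  show "summable (\<lambda>i. norm (1 / (real i) ^ 2))"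
    using inverse_power_summable[of 2] by (simp add: field_simps)
  define a where "a = - \<rho> * ln 2"
  have "0 < a" using assms by (simp add: a_def mult_neg_pos)
  then have "(\<lambda>i. (2 * real i + 2)\<^sup>2 * exp (- (a * real i))) \<in> O(\<lambda>i. 1 / (real i) ^ 2)"
    by real_asymp
  then show "(\<lambda>i. (2 * real i + 2)\<^sup>2 * 2 powr (\<rho> * real i)) \<in> O(\<lambda>i. 1 / (real i) ^ 2)"
    by (simp add: powr_def a_def mult_ac)
qed

lemma summable_double_exponential:
  fixes \<epsilon> C :: real
  assumes "0 < \<epsilon>" "0 < C"
  shows "summable (\<lambda>i. 17 * 4 ^ i * exp (- (C * (2 ^ i) powr \<epsilon>)))"
proof (rule summable_comparison_test_bigo)
  show "summable (\<lambda>i. norm (1 / (real i) ^ 2))"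
    using inverse_power_summable[of 2] by (simp add: field_simps)
  show "(\<lambda>i. 17 * 4 ^ i * exp (- (C * (2 ^ i) powr \<epsilon>))) \<in> O(\<lambda>i. 1 / (real i) ^ 2)"
    using assms by real_asymp
qed

text \<open>Rounding up keeps at least \<open>h powr \<delta>\<close> sites for the tail
  estimate.\<close>

definition window :: "real \<Rightarrow> nat \<Rightarrow> nat" where
  "window \<delta> h = nat \<lceil>real h powr \<delta>\<rceil>"

lemma window_ge: "real h powr \<delta> \<le> real (window \<delta> h)"
  unfolding window_def by linarith

lemma window_bounds:
  assumes "1 \<le> h" "0 \<le> \<delta>" "\<delta> \<le> 1"
  shows "1 \<le> window \<delta> h" "window \<delta> h \<le> h" "real (window \<delta> h) \<le> 2 * real h powr \<delta>"
proof -
  have 1: "1 \<le> real h powr \<delta>" using assms ge_one_powr_ge_zero[of "real h" \<delta>] by simp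
  then have "1 \<le> real (window \<delta> h)" using window_ge[of h \<delta>] by linarith
  then show "1 \<le> window \<delta> h" by simp
  have "real h powr \<delta> \<le> real h powr 1" using assms by (intro powr_mono) auto
  then have "real h powr \<delta> \<le> real h" using assms by simp
  then show "window \<delta> h \<le> h" by (simp add: window_def)
  have "real (window \<delta> h) < real h powr \<delta> + 1" using 1 unfolding window_def by linarith
  then show "real (window \<delta> h) \<le> 2 * real h powr \<delta>" using 1 by linarith
qed

text \<open>For h = 2^i and l of order h^\<delta>, the block bound is of order i^2 h^((3 \<delta> -
  1) / 2), which decays geometrically in i up to the square because \<delta> < 1 / 3.\<close>

lemma (in comb_profile) summable_wcoll:
  fixes \<delta> :: real
  assumes \<delta>: "0 < \<delta>" "\<delta> < 1 / 3"
    and rich: "\<And>i. i0 \<le> i \<Longrightarrow> rich K (2 ^ i) (window \<delta> (2 ^ i))"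
  shows "summable wcoll"
proof (rule summable_blocks[where ?i0.0 = "max i0 1"])
  \<comment> \<open>The constant rounds up 4 * 96768 = 387072.\<close>
  define c where "c i = 400000 * ((2 * real i + 2)\<^sup>2 * 2 powr ((3 * \<delta> - 1) / 2 * real i))" for i :: nat
  show "summable c"
    unfolding c_def using \<delta> by (intro summable_mult summable_poly_geometric) simp
  show "(\<Sum>t=4 ^ i..<4 ^ Suc i. wcoll t) \<le> c i" if i: "max i0 1 \<le> i" for i
  proof -
    define h :: nat where "h = 2 ^ i"
    define l where "l = window \<delta> h"
    define x where "x = real h"
    have x: "0 < x" "x = 2 powr real i" by (simp_all add: x_def h_def powr_realpow)
    \<comment> \<open>This is why the blocks start at \<open>max i0 1\<close>.\<close>
    have h2: "2 \<le> h" using i power_increasing[of 1 i "2 :: nat"] by (simp add: h_def)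
    have l: "1 \<le> l" "l \<le> h" "real l \<le> 2 * x powr \<delta>"
      unfolding l_def x_def using window_bounds[of h \<delta>] h2 \<delta> by auto
    have "rich K h l" using rich i by (simp add: h_def l_def)
    moreover have "ln (4 * (real h)\<^sup>2) \<le> 2 * real i + 2"
    proof -
      have "4 * (real h)\<^sup>2 = (2 :: real) ^ (2 * i + 2)"
        by (simp add: h_def power_add power_mult power2_eq_square power_mult_distrib[symmetric])
      then have "ln (4 * (real h)\<^sup>2) = real (2 * i + 2) * ln 2" by (simp only: ln_realpow)
      also have "\<dots> \<le> real (2 * i + 2) * 1"
        using ln_2_less_1 by (intro mult_left_mono) auto
      finally show ?thesis by simp
    qed
    ultimately have "(\<Sum>t=h\<^sup>2..<4 * h\<^sup>2. wcoll t)
        \<le> 96768 * (2 * real i + 2)\<^sup>2 * sqrt (real l / real h ^ 3) * (real h * real l)"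
      using l(1,2) h2 by (intro block_bound) auto
    also have "\<dots> = 96768 * (2 * real i + 2)\<^sup>2 * (sqrt (real l / x ^ 3) * (x * real l))"
      by (simp add: x_def)
    \<comment> \<open>Under the root the factor 2 in the bound on \<open>l\<close> is relaxed to 4,
      so that it leaves the root as a 2.\<close>
    also have "\<dots> \<le> 96768 * (2 * real i + 2)\<^sup>2 * (sqrt (4 * (x powr \<delta> / x ^ 3)) * (x * (2 * x powr \<delta>)))"
    proof (intro mult_left_mono mult_mono real_sqrt_le_mono)
      have "real l / x ^ 3 \<le> 4 * x powr \<delta> / x ^ 3"
      proof (rule divide_right_mono)
        show "real l \<le> 4 * x powr \<delta>" using l(3) powr_ge_zero[of x \<delta>] by linarith
      qed (use x(1) in simp)
      then show "real l / x ^ 3 \<le> 4 * (x powr \<delta> / x ^ 3)" by simp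
    qed (use x l in auto)
    also have "sqrt (4 * (x powr \<delta> / x ^ 3)) * (x * (2 * x powr \<delta>)) = 4 * x powr ((3 * \<delta> - 1) / 2)"
    proof -
      have "x powr \<delta> / x ^ 3 = x powr (\<delta> - 3)"
        using x(1) powr_realpow[of x 3] by (simp add: powr_diff)
      then have "sqrt (x powr \<delta> / x ^ 3) = x powr ((\<delta> - 3) / 2)"
        using x(1) by (simp add: powr_half_sqrt[symmetric] powr_powr)
      then have "sqrt (4 * (x powr \<delta> / x ^ 3)) = 2 * x powr ((\<delta> - 3) / 2)"
        unfolding real_sqrt_mult by simp
      then have "sqrt (4 * (x powr \<delta> / x ^ 3)) * (x * (2 * x powr \<delta>))
          = 4 * (x powr ((\<delta> - 3) / 2) * (x powr 1 * x powr \<delta>))"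
        using x(1) by (simp only:) simp
      also have "x powr ((\<delta> - 3) / 2) * (x powr 1 * x powr \<delta>) = x powr ((3 * \<delta> - 1) / 2)"
        unfolding powr_add[symmetric] by (rule arg_cong[where f = "(powr) x"]) (simp add: field_simps)
      finally show ?thesis .
    qed
    also have "x powr ((3 * \<delta> - 1) / 2) = 2 powr ((3 * \<delta> - 1) / 2 * real i)"
      by (simp add: x(2) powr_powr mult.commute)
    finally have "(\<Sum>t=h\<^sup>2..<4 * h\<^sup>2. wcoll t)
        \<le> 387072 * ((2 * real i + 2)\<^sup>2 * 2 powr ((3 * \<delta> - 1) / 2 * real i))"
      by simp
    also have "\<dots> \<le> c i" unfolding c_def by (intro mult_right_mono) auto
    finally show ?thesis
      by (simp add: h_def power_mult[symmetric] mult.commute[of i] power_mult)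
  qed
qed (rule wcoll_nonneg)

text \<open>By independence a window of at least h^\<delta> sites has no tooth of height
  \<open>h\<close> or more with probability at most exp (- C h^(\<delta> - \<gamma>)). A union bound
  over the 16 h^2 + 1 \<le> 17 h^2 starting points is still summable along h = 2^i, and
  Borel-Cantelli applies.\<close>

lemma rich_profile_AE:
  fixes M :: "'a measure" and K :: "int \<Rightarrow> 'a \<Rightarrow> real" and \<gamma> \<delta> C :: real
  assumes "prob_space M" and C: "C > 0" and \<delta>: "\<gamma> < \<delta>"
    and indep: "prob_space.indep_vars M (\<lambda>_. borel) K UNIV"
    and ident: "\<And>x. distr M borel (K x) = distr M borel (K 0)"
    and tail: "\<And>t. t \<ge> 1 \<Longrightarrow> measure M {\<omega> \<in> space M. K 0 \<omega> > t} \<ge> C * t powr (- \<gamma>)"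
  shows "AE \<omega> in M. \<forall>\<^sub>F i in sequentially. rich (\<lambda>x. K x \<omega>) (2 ^ i) (window \<delta> (2 ^ i))"
proof -
  interpret prob_space M by fact
  have meas [measurable]: "K x \<in> borel_measurable M" for x
    using indep by (simp add: indep_vars_def)
  define low where "low h y = {\<omega> \<in> space M. \<forall>x\<in>{y..<y + int (window \<delta> h)}. K x \<omega> < real h}" for h y
  define poor where "poor h = (\<Union>y\<in>{- 8 * int (h\<^sup>2)..8 * int (h\<^sup>2)}. low h y)" for h
  have [measurable]: "low h y \<in> sets M" "poor h \<in> sets M" for h y
    unfolding low_def poor_def by measurable
  have one_site: "prob (K x -` {..<real h} \<inter> space M) \<le> exp (- (C * real h powr (- \<gamma>)))"
    if "1 \<le> h" for x h
  proof -
    have "prob (K x -` {..<real h} \<inter> space M) = measure (distr M borel (K x)) {..<real h}"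
      by (simp add: measure_distr)
    also have "\<dots> = prob (K 0 -` {..<real h} \<inter> space M)"
      by (simp add: ident[of x] measure_distr)
    also have "\<dots> \<le> prob (space M - {\<omega> \<in> space M. K 0 \<omega> > real h})"
      by (intro finite_measure_mono) auto
    also have "\<dots> = 1 - prob {\<omega> \<in> space M. K 0 \<omega> > real h}"
      by (intro prob_compl) measurable
    also have "\<dots> \<le> 1 - C * real h powr (- \<gamma>)"
      using tail[of "real h"] that by simp
    also have "\<dots> \<le> exp (- (C * real h powr (- \<gamma>)))"
      using exp_ge_add_one_self[of "- (C * real h powr (- \<gamma>))"] by simp
    finally show ?thesis .
  qed
  have low: "prob (low h y) \<le> exp (- (C * real h powr (\<delta> - \<gamma>)))" if h: "1 \<le> h" for h y
  proof -
    define J where "J = {y..<y + int (window \<delta> h)}"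
    have "0 < real h powr \<delta>" using h by simp
    then have "0 < window \<delta> h" using window_ge[of h \<delta>] by (cases "window \<delta> h") auto
    then have J: "J \<noteq> {}" "finite J" "card J = window \<delta> h" by (auto simp: J_def)
    have "low h y = (\<Inter>x\<in>J. K x -` {..<real h} \<inter> space M)"
      using J(1) by (auto simp: low_def J_def)
    also have "prob \<dots> = (\<Prod>x\<in>J. prob (K x -` {..<real h} \<inter> space M))"
      using J by (intro indep_varsD[OF indep]) auto
    also have "\<dots> \<le> (\<Prod>x\<in>J. exp (- (C * real h powr (- \<gamma>))))"
      using one_site[OF h] by (intro prod_mono) auto
    also have "\<dots> = exp (- (real (window \<delta> h) * (C * real h powr (- \<gamma>))))"
      using J by (simp add: exp_of_nat_mult[symmetric])
    also have "\<dots> \<le> exp (- (C * real h powr (\<delta> - \<gamma>)))"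
    proof -
      have "real h powr \<delta> * (C * real h powr (- \<gamma>)) \<le> real (window \<delta> h) * (C * real h powr (- \<gamma>))"
        using window_ge C by (intro mult_right_mono) auto
      moreover have "real h powr (\<delta> - \<gamma>) = real h powr \<delta> * real h powr (- \<gamma>)"
        by (simp add: powr_add[symmetric])
      ultimately show ?thesis by (simp add: mult_ac)
    qed
    finally show ?thesis .
  qed
  have poor: "prob (poor (2 ^ i)) \<le> 17 * 4 ^ i * exp (- (C * (2 ^ i) powr (\<delta> - \<gamma>)))" for i
  proof -
    let ?h = "2 ^ i :: nat"
    let ?Y = "{- 8 * int (?h\<^sup>2)..8 * int (?h\<^sup>2)}"
    have "prob (poor ?h) \<le> (\<Sum>y\<in>?Y. prob (low ?h y))"
      unfolding poor_def by (intro finite_measure_subadditive_finite) auto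
    also have "\<dots> \<le> (\<Sum>y\<in>?Y. exp (- (C * real ?h powr (\<delta> - \<gamma>))))"
      by (intro sum_mono low) simp
    also have "\<dots> = real (card ?Y) * exp (- (C * (2 ^ i) powr (\<delta> - \<gamma>)))"
      by simp
    also have "\<dots> \<le> 17 * 4 ^ i * exp (- (C * (2 ^ i) powr (\<delta> - \<gamma>)))"
    proof (intro mult_right_mono)
      have sq: "?h\<^sup>2 = 4 ^ i" by (simp add: power_mult[symmetric] mult.commute[of i] power_mult)
      have "card ?Y = nat (16 * int (4 ^ i) + 1)" unfolding sq by simp
      then have "real (card ?Y) = 16 * 4 ^ i + 1" by (simp add: nat_add_distrib)
      also have "\<dots> \<le> 17 * (4 :: real) ^ i" using one_le_power[of "4 :: real" i] by simp
      finally show "real (card ?Y) \<le> 17 * 4 ^ i" .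
    qed simp
    finally show ?thesis .
  qed
  have "summable (\<lambda>i. prob (poor (2 ^ i)))"
    using summable_double_exponential[of "\<delta> - \<gamma>" C] C \<delta> poor
    by (intro summable_comparison_test[OF _ summable_double_exponential[of "\<delta> - \<gamma>" C]]) auto
  then have "AE \<omega> in M. \<forall>\<^sub>F i in sequentially. \<omega> \<in> space M - poor (2 ^ i)"
    by (intro borel_cantelli_AE1) (auto simp: emeasure_eq_measure)
  then show ?thesis
  proof (rule AE_mp, intro AE_I2 impI)
    fix \<omega> assume "\<forall>\<^sub>F i in sequentially. \<omega> \<in> space M - poor (2 ^ i)"
    then show "\<forall>\<^sub>F i in sequentially. rich (\<lambda>x. K x \<omega>) (2 ^ i) (window \<delta> (2 ^ i))"
    proof eventually_elim
      case (elim i)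
      show ?case
        unfolding rich_def
      proof (intro allI impI)
        fix y :: int assume "\<bar>y\<bar> \<le> 8 * int ((2 ^ i)\<^sup>2)"
        then have "\<omega> \<notin> low (2 ^ i) y" using elim by (auto simp: poor_def abs_le_iff)
        then show "\<exists>x. y \<le> x \<and> x < y + int (window \<delta> (2 ^ i)) \<and> real (2 ^ i) \<le> K x \<omega>"
          using elim by (auto simp: low_def not_less)
      qed
    qed
  qed
qed

theorem theorem4p16:
  fixes M :: "'a measure" and K :: "int \<Rightarrow> 'a \<Rightarrow> real" and \<gamma> C :: real
  assumes "0 < \<gamma>" and "\<gamma> < 1 / 3" and "C > 0"
    and "prob_space M"
    and nonneg: "\<And>x \<omega>. \<omega> \<in> space M \<Longrightarrow> K x \<omega> \<ge> 0"
    and indep: "prob_space.indep_vars M (\<lambda>_. borel) K UNIV"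
    and ident: "\<And>x. distr M borel (K x) = distr M borel (K 0)"
    and tail: "\<And>t. t \<ge> 1 \<Longrightarrow> measure M {\<omega> \<in> space M. K 0 \<omega> > t} \<ge> C * t powr (- \<gamma>)"
  shows "AE \<omega> in M. finite_collision_property (comb (\<lambda>x. K x \<omega>))"
proof -
  \<comment> \<open>The gap above \<open>\<gamma>\<close> makes long teeth frequent enough; the gap
    below 1 / 3 makes the block bounds summable.\<close>
  obtain \<delta> where \<delta>: "\<gamma> < \<delta>" "\<delta> < 1 / 3"
    using dense[OF \<open>\<gamma> < 1 / 3\<close>] by auto
  have "AE \<omega> in M. \<forall>\<^sub>F i in sequentially. rich (\<lambda>x. K x \<omega>) (2 ^ i) (window \<delta> (2 ^ i))"
    by (rule rich_profile_AE[OF assms(4) \<open>C > 0\<close> \<delta>(1) indep ident tail])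
  then show ?thesis
  proof (rule AE_mp, intro AE_I2 impI)
    fix \<omega> assume \<omega>: "\<omega> \<in> space M"
      and "\<forall>\<^sub>F i in sequentially. rich (\<lambda>x. K x \<omega>) (2 ^ i) (window \<delta> (2 ^ i))"
    \<comment> \<open>The threshold depends on \<open>\<omega>\<close>, which is harmless since
      summability ignores finitely many blocks.\<close>
    then obtain i0 where i0: "\<And>i. i0 \<le> i \<Longrightarrow> rich (\<lambda>x. K x \<omega>) (2 ^ i) (window \<delta> (2 ^ i))"
      by (auto simp: eventually_sequentially)
    interpret comb_profile "\<lambda>x. K x \<omega>"
      using nonneg[OF \<omega>] by unfold_locales
    show "finite_collision_property (comb (\<lambda>x. K x \<omega>))"
      using \<open>0 < \<gamma>\<close> \<delta> i0 by (intro finite_collision_propertyI summable_wcoll[of \<delta> i0]) auto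
  qed
qed

end
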